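(* For Monotone bandits with switching costs, the BalancedIndex policy defined in the context is a $2$-approximation: its time-average expected reward minus switching costs is at least half that of an optimal policy.
   Context: Monotone bandits: $n$ arms; arm $i$ has a finite state set $\mathcal S_i$. At each step a policy plays at most one arm. An unplayed arm stays in its state and yields no reward. If arm $i$ is in state $k$ and is played, where $t\ge1$ is the number of steps since arm $i$ was last played, it yields reward $r^i_k\ge0$ and then moves to $j\ne k$ with probability $f^i_k(t)q^i(k,j)$, staying in $k$ otherwise; arms transition independently. Here $q^i(k,j)\ge0$, $\sum_{j\ne k}q^i(k,j)\le1$, $f^i_k:\{1,2,\dots\}\to[0,1]$ non-decreasing and piecewise linear with polynomial-size breakpoint set $\mathcal W^i_k\ni1$ (constant after the last breakpoint); for each $i$ the directed graph on $\mathcal S_i$ with edges $(j,k)$ for $q^i(j,k)>0$ is strongly connected; the policy may choose starting states. Switching costs: when the arm played differs from the previously played arm, a closing cost $c_i\ge0$ of the old arm $i$ and a setup cost $s_j\ge0$ of the new arm $j$ are paid (subtracted from the reward). The value of a policy is the infinite-horizon time-average expected reward minus switching cost. Balanced dual LP, with $\Delta P^i_k=\sum_{j\ne k}q^i(k,j)(p^i_j-p^i_k)$ and free $p^i_k$: minimize $\lambda+\sum_ih_i$ subject to, for all $i$, $k\in\mathcal S_i$, $t\ge1$: $\lambda+th_i\ge r^i_k-c_i-s_i+f^i_k(t)\Delta P^i_k$ and $t(\lambda+h_i)\ge r^i_k+f^i_k(t)\Delta P^i_k$; $\lambda=\sum_ih_i$; $\lambda,h_i\ge0$. BalancedIndex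 policy: take an optimal solution. If for some arm $i$ with $h_i>0$ there is a state $k$ for which none of these constraints is tight for any $t$, repeatedly play a single arm whose repeated play yields per-step reward at least $\lambda+h_i$. Otherwise consider only arms with $h_i>0$; for each such $i$ and $k\in\mathcal S_i$ let $t^i_k$ be the smallest $t$ for which one of the two constraints for $(i,k,t)$ is tight; $k\in\mathcal G_i$ if $t^i_k(\lambda+h_i)=r^i_k+f^i_k(t^i_k)\Delta P^i_k$, and otherwise $k\in\mathcal I_i$, in which case an arm in state $k$ becomes "ready" after $t^i_k$ steps since its last play. The policy sticks with an arm $i$ as long as its state is some $k\in\mathcal G_i$, playing it after waiting $t^i_k-1$ steps; otherwise it plays any ready arm; if no such arm is available it idles. *)

theory Defs
  imports "HOL-Probability.Probability"
begin

section \<open>Monotone bandits with switching costs\<close>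

text \<open>The arms are the elements of the finite type \<^typ>\<open>'i\<close>.  Fields: \<open>states i\<close> is
  \<open>S_i\<close>; \<open>reward i k\<close> is \<open>r^i_k\<close>; \<open>rate i k j\<close> is \<open>q^i(k,j)\<close>; \<open>ramp i k t\<close> is
  \<open>f^i_k(t)\<close>, meaningful for \<open>t \<ge> 1\<close> only; \<open>breaks i k\<close> is \<open>W^i_k\<close>.\<close>

record ('i, 's) bandit =
  states :: "'i \<Rightarrow> 's set"
  reward :: "'i \<Rightarrow> 's \<Rightarrow> real"
  rate :: "'i \<Rightarrow> 's \<Rightarrow> 's \<Rightarrow> real"
  ramp :: "'i \<Rightarrow> 's \<Rightarrow> nat \<Rightarrow> real"
  breaks :: "'i \<Rightarrow> 's \<Rightarrow> nat set"
  closing :: "'i \<Rightarrow> real"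
  setup_cost :: "'i \<Rightarrow> real"

definition piecewise_linear :: "nat set \<Rightarrow> (nat \<Rightarrow> real) \<Rightarrow> bool" where
  "piecewise_linear W f \<longleftrightarrow>
     finite W \<and> 1 \<in> W \<and> 0 \<notin> W \<and>
     (\<forall>a\<in>W. \<forall>b\<in>W. a < b \<and> W \<inter> {a<..<b} = {} \<longrightarrow>
        (\<forall>t\<in>{a..b}. f t = f a + (f b - f a) * (real t - real a) / (real b - real a))) \<and>
     (\<forall>t\<ge>Max W. f t = f (Max W))"

definition monotone_bandit :: "('i::finite, 's) bandit \<Rightarrow> bool" where
  "monotone_bandit B \<longleftrightarrow>
     (\<forall>i. finite (states B i) \<and> states B i \<noteq> {} \<and> closing B i \<ge> 0 \<and> setup_cost B i \<ge> 0) \<and>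
     (\<forall>i. \<forall>k\<in>states B i.
        reward B i k \<ge> 0 \<and>
        (\<forall>j\<in>states B i. rate B i k j \<ge> 0) \<and>
        (\<Sum>j\<in>states B i - {k}. rate B i k j) \<le> 1 \<and>
        (\<forall>t\<ge>1. ramp B i k t \<in> {0..1}) \<and>
        mono_on {1..} (ramp B i k) \<and>
        piecewise_linear (breaks B i k) (ramp B i k)) \<and>
     (\<forall>i. \<forall>j\<in>states B i. \<forall>k\<in>states B i.
        (j, k) \<in> {(a, b). a \<in> states B i \<and> b \<in> states B i \<and> rate B i a b > 0}\<^sup>*)"


section \<open>Dynamics, policies and their values\<close>

text \<open>\<open>elapsed c i\<close> is the number of steps since arm \<open>i\<close> was last played; it is \<open>1\<close> right
  after a step in which \<open>i\<close> was played.  \<open>last_played c\<close> is unaffected by idling.\<close>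

record ('i, 's) config =
  state :: "'i \<Rightarrow> 's"
  elapsed :: "'i \<Rightarrow> nat"
  last_played :: "'i option"

text \<open>Before its first play the elapsed time of an arm is not determined by the model.  Like the
  starting state it is left open here (any value \<open>\<ge> 1\<close>).\<close>

definition starts :: "('i, 's) bandit \<Rightarrow> ('i, 's) config set" where
  "starts B = {c. (\<forall>i. state c i \<in> states B i \<and> elapsed c i \<ge> 1) \<and> last_played c = None}"

definition move :: "('i, 's) bandit \<Rightarrow> 'i \<Rightarrow> 's \<Rightarrow> nat \<Rightarrow> 's pmf" where
  "move B i k t = embed_pmf (\<lambda>j.
     if j = k then 1 - (\<Sum>j'\<in>states B i - {k}. ramp B i k t * rate B i k j')
     else if j \<in> states B i then ramp B i k t * rate B i k j
     else 0)"

text \<open>The function defining \<^const>\<open>move\<close> really is a probability mass function.\<close>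

lemma pmf_move:
  assumes "monotone_bandit B" "k \<in> states B i" "t \<ge> 1"
  shows "pmf (move B i k t) j =
     (if j = k then 1 - (\<Sum>j'\<in>states B i - {k}. ramp B i k t * rate B i k j')
      else if j \<in> states B i then ramp B i k t * rate B i k j
      else 0)"
proof -
  let ?S = "states B i" and ?f = "ramp B i k t"
  let ?g = "\<lambda>j. if j = k then 1 - (\<Sum>j'\<in>?S - {k}. ?f * rate B i k j')
      else if j \<in> ?S then ?f * rate B i k j else 0"
  have fin: "finite ?S" and f: "0 \<le> ?f" "?f \<le> 1"
    and q: "\<And>j. j \<in> ?S \<Longrightarrow> 0 \<le> rate B i k j" and s: "(\<Sum>j\<in>?S - {k}. rate B i k j) \<le> 1"
    using assms by (auto simp: monotone_bandit_def)
  have "(\<Sum>j'\<in>?S - {k}. ?f * rate B i k j') = ?f * (\<Sum>j'\<in>?S - {k}. rate B i k j')"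
    by (simp add: sum_distrib_left)
  also have "\<dots> \<le> 1 * 1"
    using f s q by (intro mult_mono) (auto intro: sum_nonneg)
  finally have le: "(\<Sum>j'\<in>?S - {k}. ?f * rate B i k j') \<le> 1" by simp
  have nn: "0 \<le> ?g j" for j
    using le f q by auto
  have "(\<integral>\<^sup>+ j. ennreal (?g j) \<partial>count_space UNIV) = (\<Sum>j\<in>?S. ennreal (?g j))"
    using assms(2) fin by (intro nn_integral_count_space'[where A = ?S]) (auto split: if_splits)
  also have "\<dots> = ennreal (\<Sum>j\<in>?S. ?g j)"
    using nn by (intro sum_ennreal)
  also have "(\<Sum>j\<in>?S. ?g j) = 1"
    using assms(2) fin by (subst sum.remove[of _ k]) (auto intro!: sum.cong)
  finally have "(\<integral>\<^sup>+ j. ennreal (?g j) \<partial>count_space UNIV) = 1" by simp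
  then show ?thesis
    unfolding move_def using nn by (subst pmf_embed_pmf) auto
qed

text \<open>Actions: \<open>None\<close> idles, \<open>Some i\<close> plays arm \<open>i\<close>.\<close>

definition step :: "('i, 's) bandit \<Rightarrow> ('i, 's) config \<Rightarrow> 'i option \<Rightarrow> ('i, 's) config pmf" where
  "step B c a = (case a of
     None \<Rightarrow> return_pmf (c\<lparr>elapsed := \<lambda>j. Suc (elapsed c j)\<rparr>)
   | Some i \<Rightarrow> map_pmf
       (\<lambda>k. \<lparr>state = (state c)(i := k),
             elapsed = (\<lambda>j. if j = i then 1 else Suc (elapsed c j)),
             last_played = Some i\<rparr>)
       (move B i (state c i) (elapsed c i)))"

definition switching_cost :: "('i, 's) bandit \<Rightarrow> 'i option \<Rightarrow> 'i \<Rightarrow> real" where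
  "switching_cost B l j = (case l of
     None \<Rightarrow> 0
   | Some i \<Rightarrow> if i = j then 0 else closing B i + setup_cost B j)"

definition payoff :: "('i, 's) bandit \<Rightarrow> ('i, 's) config \<Rightarrow> 'i option \<Rightarrow> real" where
  "payoff B c a = (case a of
     None \<Rightarrow> 0
   | Some i \<Rightarrow> reward B i (state c i) - switching_cost B (last_played c) i)"

text \<open>Policies are randomized and see the whole past (configurations and actions) as well as the
  current configuration.\<close>

type_synonym ('i, 's) past = "(('i, 's) config \<times> 'i option) list"
type_synonym ('i, 's) policy = "('i, 's) past \<Rightarrow> ('i, 's) config \<Rightarrow> 'i option pmf"

primrec run :: "('i, 's) bandit \<Rightarrow> ('i, 's) policy \<Rightarrow> ('i, 's) config \<Rightarrow> nat
    \<Rightarrow> (('i, 's) past \<times> ('i, 's) config) pmf" where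
  "run B \<pi> c0 0 = return_pmf ([], c0)"
| "run B \<pi> c0 (Suc n) =
     bind_pmf (run B \<pi> c0 n) (\<lambda>(past, c).
       bind_pmf (\<pi> past c) (\<lambda>a.
         map_pmf (\<lambda>c'. (past @ [(c, a)], c')) (step B c a)))"

definition expected_payoff ::
    "('i, 's) bandit \<Rightarrow> ('i, 's) policy \<Rightarrow> ('i, 's) config \<Rightarrow> nat \<Rightarrow> real" where
  "expected_payoff B \<pi> c0 n =
     measure_pmf.expectation
       (bind_pmf (run B \<pi> c0 n) (\<lambda>(past, c). map_pmf (payoff B c) (\<pi> past c))) (\<lambda>x. x)"

definition average_payoff ::
    "('i, 's) bandit \<Rightarrow> ('i, 's) policy \<Rightarrow> ('i, 's) config \<Rightarrow> nat \<Rightarrow> real" where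
  "average_payoff B \<pi> c0 T = (\<Sum>n<T. expected_payoff B \<pi> c0 n) / real T"

text \<open>The time averages of a history-dependent policy need not converge.  The lower value is used
  for the policy that is being analysed and the upper value for its competitors, so that the
  comparison covers every convention for the infinite-horizon average.\<close>

definition lower_value :: "('i, 's) bandit \<Rightarrow> ('i, 's) policy \<Rightarrow> ('i, 's) config \<Rightarrow> ereal" where
  "lower_value B \<pi> c0 = liminf (\<lambda>T. ereal (average_payoff B \<pi> c0 T))"

definition upper_value :: "('i, 's) bandit \<Rightarrow> ('i, 's) policy \<Rightarrow> ('i, 's) config \<Rightarrow> ereal" where
  "upper_value B \<pi> c0 = limsup (\<lambda>T. ereal (average_payoff B \<pi> c0 T))"

definition optimal_value :: "('i, 's) bandit \<Rightarrow> ereal" where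
  "optimal_value B = (SUP c0 \<in> starts B. SUP \<pi>. upper_value B \<pi> c0)"


section \<open>The balanced dual linear program\<close>

record ('i, 's) dual =
  lam :: real
  hval :: "'i \<Rightarrow> real"
  pot :: "'i \<Rightarrow> 's \<Rightarrow> real"

definition drift :: "('i, 's) bandit \<Rightarrow> ('i, 's) dual \<Rightarrow> 'i \<Rightarrow> 's \<Rightarrow> real" where
  "drift B D i k = (\<Sum>j\<in>states B i - {k}. rate B i k j * (pot D i j - pot D i k))"

definition switch_lhs :: "('i, 's) dual \<Rightarrow> 'i \<Rightarrow> nat \<Rightarrow> real" where
  "switch_lhs D i t = lam D + real t * hval D i"

definition switch_rhs :: "('i, 's) bandit \<Rightarrow> ('i, 's) dual \<Rightarrow> 'i \<Rightarrow> 's \<Rightarrow> nat \<Rightarrow> real" where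
  "switch_rhs B D i k t =
     reward B i k - closing B i - setup_cost B i + ramp B i k t * drift B D i k"

definition stay_lhs :: "('i, 's) dual \<Rightarrow> 'i \<Rightarrow> nat \<Rightarrow> real" where
  "stay_lhs D i t = real t * (lam D + hval D i)"

definition stay_rhs :: "('i, 's) bandit \<Rightarrow> ('i, 's) dual \<Rightarrow> 'i \<Rightarrow> 's \<Rightarrow> nat \<Rightarrow> real" where
  "stay_rhs B D i k t = reward B i k + ramp B i k t * drift B D i k"

definition dual_feasible :: "('i::finite, 's) bandit \<Rightarrow> ('i, 's) dual \<Rightarrow> bool" where
  "dual_feasible B D \<longleftrightarrow>
     (\<forall>i. \<forall>k\<in>states B i. \<forall>t\<ge>1.
        switch_lhs D i t \<ge> switch_rhs B D i k t \<and> stay_lhs D i t \<ge> stay_rhs B D i k t) \<and>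
     lam D = (\<Sum>i\<in>UNIV. hval D i) \<and>
     lam D \<ge> 0 \<and> (\<forall>i. hval D i \<ge> 0)"

definition dual_objective :: "('i::finite, 's) dual \<Rightarrow> real" where
  "dual_objective D = lam D + (\<Sum>i\<in>UNIV. hval D i)"

definition dual_optimal :: "('i::finite, 's) bandit \<Rightarrow> ('i, 's) dual \<Rightarrow> bool" where
  "dual_optimal B D \<longleftrightarrow>
     dual_feasible B D \<and> (\<forall>D'. dual_feasible B D' \<longrightarrow> dual_objective D \<le> dual_objective D')"


section \<open>The BalancedIndex policy\<close>

definition tight :: "('i, 's) bandit \<Rightarrow> ('i, 's) dual \<Rightarrow> 'i \<Rightarrow> 's \<Rightarrow> nat \<Rightarrow> bool" where
  "tight B D i k t \<longleftrightarrow>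
     switch_lhs D i t = switch_rhs B D i k t \<or> stay_lhs D i t = stay_rhs B D i k t"

definition never_tight :: "('i, 's) bandit \<Rightarrow> ('i, 's) dual \<Rightarrow> 'i \<Rightarrow> bool" where
  "never_tight B D i \<longleftrightarrow> (\<exists>k\<in>states B i. \<forall>t\<ge>1. \<not> tight B D i k t)"

definition first_tight :: "('i, 's) bandit \<Rightarrow> ('i, 's) dual \<Rightarrow> 'i \<Rightarrow> 's \<Rightarrow> nat" where
  "first_tight B D i k = (LEAST t. t \<ge> 1 \<and> tight B D i k t)"

definition good_states :: "('i, 's) bandit \<Rightarrow> ('i, 's) dual \<Rightarrow> 'i \<Rightarrow> 's set" where
  "good_states B D i =
     {k \<in> states B i. let t = first_tight B D i k in stay_lhs D i t = stay_rhs B D i k t}"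

definition index_states :: "('i, 's) bandit \<Rightarrow> ('i, 's) dual \<Rightarrow> 'i \<Rightarrow> 's set" where
  "index_states B D i = states B i - good_states B D i"

definition good_arms :: "('i, 's) bandit \<Rightarrow> ('i, 's) dual \<Rightarrow> ('i, 's) config \<Rightarrow> 'i set" where
  "good_arms B D c = {i. hval D i > 0 \<and> state c i \<in> good_states B D i}"

definition due :: "('i, 's) bandit \<Rightarrow> ('i, 's) dual \<Rightarrow> ('i, 's) config \<Rightarrow> 'i \<Rightarrow> bool" where
  "due B D c i \<longleftrightarrow> elapsed c i \<ge> first_tight B D i (state c i)"

definition ready_arms :: "('i, 's) bandit \<Rightarrow> ('i, 's) dual \<Rightarrow> ('i, 's) config \<Rightarrow> 'i set" where
  "ready_arms B D c = {i. hval D i > 0 \<and> state c i \<in> index_states B D i \<and> due B D c i}"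

text \<open>The arm to stick with is the last played one if it is in a good state.  An arm enters a good
  state only by being played, and is then not left before it leaves the good states; so another
  arm can be in a good state only if it has been there from the start.  Such arms are taken up,
  in any order, whenever the last played arm (if any) is not in a good state.\<close>

definition stick_arms :: "('i, 's) bandit \<Rightarrow> ('i, 's) dual \<Rightarrow> ('i, 's) config \<Rightarrow> 'i set" where
  "stick_arms B D c =
     (if \<exists>i\<in>good_arms B D c. last_played c = Some i
      then {i \<in> good_arms B D c. last_played c = Some i}
      else good_arms B D c)"

definition index_actions :: "('i, 's) bandit \<Rightarrow> ('i, 's) dual \<Rightarrow> ('i, 's) config \<Rightarrow> 'i option set" where
  "index_actions B D c =
     (if stick_arms B D c \<noteq> {} then
        (\<lambda>i. if due B D c i then Some i else None) ` stick_arms B D c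
      else if ready_arms B D c \<noteq> {} then Some ` ready_arms B D c
      else {None})"

text \<open>The predicate describes all instances of the policy (with arbitrary, possibly randomized and
  history-dependent, tie-breaking), together with the configurations from which they may be
  started.  In the first case the starting configuration matters, since repeated play of an arm
  may never leave the state in which it started.\<close>

definition balanced_index ::
    "('i::finite, 's) bandit \<Rightarrow> ('i, 's) dual \<Rightarrow> ('i, 's) policy \<Rightarrow> ('i, 's) config \<Rightarrow> bool" where
  "balanced_index B D \<pi> c0 \<longleftrightarrow>
     c0 \<in> starts B \<and>
     (if \<exists>i. hval D i > 0 \<and> never_tight B D i then
        \<exists>i j. hval D i > 0 \<and> never_tight B D i \<and>
          (\<forall>past c. \<pi> past c = return_pmf (Some j)) \<and>
          lower_value B \<pi> c0 \<ge> ereal (lam D + hval D i)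
      else \<forall>past c. set_pmf (\<pi> past c) \<subseteq> index_actions B D c)"

end

(* Twice the balanced dual value lam bounds every policy: take the potential that adds up pot, hval
   per elapsed step of each arm and lam per step since the last play, less the closing cost of the
   current arm.  By dual feasibility the payoff of a step plus the expected growth of the potential
   is at most lam + sum hval = 2 lam.  For the index policy, with elapsed times truncated at the
   first tight time and lam banked only while waiting in a good state, this quantity is at least
   lam: the truncated banks of arms that are not ready grow by sum hval = lam, and a play at a tight
   time pays for the bank it empties.

   The optimality of the dual solution matters only when some state of an arm with hval > 0 is never
   tight.  Then a perturbation would lower lam, unless the arm has a state that it never leaves when
   played repeatedly and whose reward is exactly lam + hval. *)

theory Submission
  imports Defs
begin

section \<open>Potentials on strongly connected state graphs\<close>

text \<open>A potential whose expected change is controlled at every step leaves, over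
  \<open>T\<close> steps, only its two end values. An upper bound on the value therefore wants a
  potential bounded below, a lower bound one bounded above. Elapsed times are unbounded: they may
  enter the first potential as they are but have to be truncated in the second. Truncation at the
  first tight time is affordable because in an index state the drift is nonnegative, so a late play
  is no worse than a timely one. In a good state the drift can be negative, but there the policy
  plays exactly on time. The exception is an arm that is in a good state from the start: it may be
  played late, and taking it up costs a switch. Each such arm is taken up once, so the second
  potential withholds a fixed amount for each. Subtracting the closing cost of the current arm in
  advance makes every switch cost the closing and setup costs of the arm being taken up, as in the
  switching constraint. Existence of an optimal dual solution is a compactness argument; the
  obstacle is that potentials of near-optimal solutions can be unbounded.\<close>

text \<open>The generator of the chain with jump rates \<open>q\<close>, without the ramp. Unlike
  \<open>drift\<close> it takes a bare potential, so that perturbed, scaled and translated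
  potentials can be handled by linearity.\<close>

definition flow :: "'s set \<Rightarrow> ('s \<Rightarrow> 's \<Rightarrow> real) \<Rightarrow> ('s \<Rightarrow> real) \<Rightarrow> 's \<Rightarrow> real" where
  "flow S q v k = (\<Sum>j\<in>S - {k}. q k j * (v j - v k))"

definition edges :: "'s set \<Rightarrow> ('s \<Rightarrow> 's \<Rightarrow> real) \<Rightarrow> ('s \<times> 's) set" where
  "edges S q = {(a, b). a \<in> S \<and> b \<in> S \<and> q a b > 0}"

lemma flow_scale: "flow S q (\<lambda>x. c * v x) k = c * flow S q v k"
  by (simp add: flow_def sum_distrib_left algebra_simps)

lemma flow_add: "flow S q (\<lambda>x. u x + v x) k = flow S q u k + flow S q v k"
  by (simp add: flow_def sum.distrib[symmetric] algebra_simps)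

lemma flow_sum: "finite A \<Longrightarrow> flow S q (\<lambda>x. \<Sum>a\<in>A. u a x) k = (\<Sum>a\<in>A. flow S q (u a) k)"
  by (induction A rule: finite_induct) (simp_all add: flow_add, simp add: flow_def)

lemma flow_shift: "flow S q (\<lambda>x. v x - c) k = flow S q v k"
  by (simp add: flow_def)

text \<open>Lowering \<open>v\<close> at a state where the flow is negative makes the flow negative at all
  predecessors of that state too.\<close>

lemma descent_at:
  assumes S: "finite S" "\<And>k j. k \<in> S \<Longrightarrow> j \<in> S \<Longrightarrow> 0 \<le> q k j"
    and path: "(j, z) \<in> (edges S q)\<^sup>*" and j: "j \<in> S - {z}"
  shows "\<exists>v. (\<forall>k\<in>S - {z}. flow S q v k \<le> 0) \<and> flow S q v j < 0"
  using path j
proof (induction rule: converse_rtrancl_induct)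
  case base
  then show ?case by simp
next
  case (step j l)
  have jl: "j \<in> S" "l \<in> S" "q j l > 0" using step.hyps(1) by (auto simp: edges_def)
  show ?case
  proof (cases "j = l")
    case True
    then show ?thesis using step by simp
  next
    case False
    have "\<exists>v. (\<forall>k\<in>S - {z}. flow S q v k \<le> 0) \<and> (l \<noteq> z \<longrightarrow> flow S q v l < 0)"
    proof (cases "l = z")
      case True
      then show ?thesis by (intro exI[of _ "\<lambda>_. 0"]) (simp add: flow_def)
    qed (use step jl in auto)
    then obtain v where v: "\<And>k. k \<in> S - {z} \<Longrightarrow> flow S q v k \<le> 0"
      "l \<noteq> z \<Longrightarrow> flow S q v l < 0" by auto
    define C where "C = (\<Sum>m\<in>S - {l}. q l m)"
    have C: "C \<ge> 0" unfolding C_def using S jl by (intro sum_nonneg) auto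
    \<comment> \<open>Lowering \<open>v l\<close> by \<open>e\<close> raises the flow at
      \<open>l\<close> by \<open>e * C\<close>, which must not exceed the negative flow available
      there; the \<open>+ 1\<close> covers \<open>C = 0\<close>. At \<open>l = z\<close> the flow is
      unconstrained and any positive \<open>e\<close> serves.\<close>
    define e where "e = (if l = z then 1 else - flow S q v l / (C + 1))"
    have e: "e > 0" using v(2) C by (auto simp: e_def divide_neg_pos)
    have eC: "e * C \<le> - flow S q v l" if "l \<noteq> z"
    proof -
      have "e * C \<le> e * (C + 1)" using e by simp
      also have "\<dots> = - flow S q v l" using that C by (simp add: e_def)
      finally show ?thesis .
    qed
    let ?v = "v(l := v l - e)"
    have at_l: "flow S q ?v l = flow S q v l + e * C"
    proof -
      have "flow S q ?v l = (\<Sum>m\<in>S - {l}. q l m * (v m - v l) + e * q l m)"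
        unfolding flow_def by (intro sum.cong) (auto simp: algebra_simps)
      then show ?thesis by (simp add: flow_def C_def sum.distrib sum_distrib_left)
    qed
    have off: "flow S q ?v k = flow S q v k - e * q k l" if "k \<in> S" "k \<noteq> l" for k
    proof -
      have "flow S q ?v k = (\<Sum>m\<in>S - {k}. q k m * (v m - v k) - (if m = l then e * q k l else 0))"
        unfolding flow_def using that by (intro sum.cong) (auto simp: algebra_simps)
      also have "\<dots> = flow S q v k - e * q k l"
        using that jl S(1) by (simp add: flow_def sum_subtractf)
      finally show ?thesis .
    qed
    have "flow S q ?v k \<le> 0" if "k \<in> S - {z}" for k
    proof (cases "k = l")
      case True
      then show ?thesis using at_l eC that by auto
    next
      case False
      have "e * q k l \<ge> 0" using e S(2)[of k l] that jl by simp
      then show ?thesis using off[of k] v(1)[of k] that False by simp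
    qed
    moreover have "flow S q ?v j < 0"
      using off[of j] v(1)[of j] jl e step.prems False by (smt (verit) mult_pos_pos)
    ultimately show ?thesis by blast
  qed
qed

text \<open>Adding the potentials of \<open>descent_at\<close> over all \<open>j\<close> makes the
  flow strictly negative everywhere but at \<open>z\<close>, and a large multiple pushes it below
  any \<open>- w\<close>. Some state has to be exempt when \<open>w > 0\<close>: the flow is
  nonnegative where \<open>v\<close> is minimal.\<close>

lemma descent_potential:
  assumes S: "finite S" "\<And>k j. k \<in> S \<Longrightarrow> j \<in> S \<Longrightarrow> 0 \<le> q k j"
    and conn: "\<And>j. j \<in> S \<Longrightarrow> (j, z) \<in> (edges S q)\<^sup>*"
  shows "\<exists>v. \<forall>k\<in>S - {z}. flow S q v k \<le> - w k"
proof -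
  have "\<forall>j\<in>S - {z}. \<exists>v. (\<forall>k\<in>S - {z}. flow S q v k \<le> 0) \<and> flow S q v j < 0"
    using descent_at[OF S conn] by blast
  then obtain u where u: "\<And>j k. j \<in> S - {z} \<Longrightarrow> k \<in> S - {z} \<Longrightarrow> flow S q (u j) k \<le> 0"
    "\<And>j. j \<in> S - {z} \<Longrightarrow> flow S q (u j) j < 0"
    by metis
  define v where "v = (\<lambda>x. \<Sum>j\<in>S - {z}. u j x)"
  have neg: "flow S q v k < 0" if k: "k \<in> S - {z}" for k
  proof -
    have "flow S q v k = (\<Sum>j\<in>S - {z}. flow S q (u j) k)"
      unfolding v_def using S(1) by (subst flow_sum) auto
    also have "\<dots> < (\<Sum>j\<in>S - {z}. 0)"
      using S(1) u k by (intro sum_strict_mono_ex1) auto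
    finally show ?thesis by simp
  qed
  \<comment> \<open>A sum of nonnegative ratios in place of their maximum, since
    \<open>S - {z}\<close> may be empty.\<close>
  define R where "R = (\<Sum>k\<in>S - {z}. \<bar>w k\<bar> / (- flow S q v k))"
  have "flow S q (\<lambda>x. R * v x) k \<le> - w k" if k: "k \<in> S - {z}" for k
  proof -
    have "\<bar>w k\<bar> / (- flow S q v k) \<le> R"
      unfolding R_def using S(1) k neg
      by (intro member_le_sum) (auto intro!: divide_nonneg_nonneg divide_nonneg_neg)
    then have "\<bar>w k\<bar> \<le> R * (- flow S q v k)"
      using neg[OF k] by (simp add: field_simps)
    then show ?thesis by (simp add: flow_scale)
  qed
  then show ?thesis by blast
qed

text \<open>A Harnack-type estimate: for an edge from \<open>j\<close> to \<open>l\<close>, bounded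
  flow at \<open>j\<close> gives \<open>q j l * v l \<le> U + v j\<close>, because the rates out of
  \<open>j\<close> sum to at most 1. So a bound spreads along paths from a zero of \<open>v\<close>,
  uniformly in \<open>v\<close>.\<close>

lemma potential_bound:
  assumes S: "finite S" "\<And>k j. k \<in> S \<Longrightarrow> j \<in> S \<Longrightarrow> 0 \<le> q k j"
    and sub: "\<And>k. k \<in> S \<Longrightarrow> (\<Sum>j\<in>S - {k}. q k j) \<le> 1"
    and conn: "\<And>j k. j \<in> S \<Longrightarrow> k \<in> S \<Longrightarrow> (j, k) \<in> (edges S q)\<^sup>*"
  shows "\<exists>C. \<forall>v. (\<forall>k\<in>S. flow S q v k \<le> U) \<and> (\<forall>k\<in>S. v k \<ge> 0) \<and> (\<exists>k\<in>S. v k = 0) \<longrightarrow>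
    (\<forall>k\<in>S. v k \<le> C)"
proof -
  have from_zero: "\<exists>C. \<forall>v. (\<forall>k\<in>S. flow S q v k \<le> U) \<and> (\<forall>k\<in>S. v k \<ge> 0) \<and> v z = 0 \<longrightarrow> v k \<le> C"
    if z: "z \<in> S" and k: "k \<in> S" for z k
    using conn[OF z k]
  proof (induction rule: rtrancl_induct)
    case base
    then show ?case by auto
  next
    case (step j l)
    then obtain C where C: "\<And>v. (\<forall>k\<in>S. flow S q v k \<le> U) \<Longrightarrow> (\<forall>k\<in>S. v k \<ge> 0) \<Longrightarrow> v z = 0
      \<Longrightarrow> v j \<le> C" by blast
    have jl: "j \<in> S" "l \<in> S" "q j l > 0" using step.hyps(2) by (auto simp: edges_def)
    show ?case
    proof (cases "j = l")
      case True
      then show ?thesis using C by blast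
    next
      case False
      have "v l \<le> (U + \<bar>C\<bar>) / q j l"
        if v: "\<forall>k\<in>S. flow S q v k \<le> U" "\<forall>k\<in>S. v k \<ge> 0" "v z = 0" for v
      proof -
        have "q j l * v l \<le> (\<Sum>m\<in>S - {j}. q j m * v m)"
          using False S jl v by (intro member_le_sum) auto
        also have "\<dots> = flow S q v j + v j * (\<Sum>m\<in>S - {j}. q j m)"
          by (simp add: flow_def sum_distrib_left sum.distrib[symmetric] algebra_simps)
        also have "v j * (\<Sum>m\<in>S - {j}. q j m) \<le> v j * 1"
          using sub[OF jl(1)] v(2) jl by (intro mult_left_mono) auto
        also have "v j * 1 \<le> \<bar>C\<bar>" using C[OF v] by simp
        finally show ?thesis using v(1) jl by (fastforce simp: field_simps)
      qed
      then show ?thesis by blast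
    qed
  qed
  then obtain C where C: "\<And>z k v. z \<in> S \<Longrightarrow> k \<in> S \<Longrightarrow> \<forall>k\<in>S. flow S q v k \<le> U \<Longrightarrow>
     \<forall>k\<in>S. v k \<ge> 0 \<Longrightarrow> v z = 0 \<Longrightarrow> v k \<le> C z k"
    by metis
  have "v k \<le> (\<Sum>z\<in>S. \<Sum>k\<in>S. \<bar>C z k\<bar>)"
    if "\<forall>k\<in>S. flow S q v k \<le> U" "\<forall>k\<in>S. v k \<ge> 0" "z \<in> S" "v z = 0" "k \<in> S" for v z k
  proof -
    have "v k \<le> \<bar>C z k\<bar>" using C[of z k v] that by simp
    also have "\<dots> \<le> (\<Sum>k\<in>S. \<bar>C z k\<bar>)" using that S(1) by (intro member_le_sum) auto
    also have "\<dots> \<le> (\<Sum>z\<in>S. \<Sum>k\<in>S. \<bar>C z k\<bar>)"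
      using that S(1) by (intro member_le_sum[of z S "\<lambda>z. \<Sum>k\<in>S. \<bar>C z k\<bar>"]) (auto intro: sum_nonneg)
    finally show ?thesis .
  qed
  then show ?thesis by blast
qed

section \<open>Average payoff and drift\<close>

lemma expectation_bind_finite:
  fixes h :: "'b \<Rightarrow> real"
  assumes "finite (set_pmf p)" "\<And>x. x \<in> set_pmf p \<Longrightarrow> finite (set_pmf (f x))"
  shows "measure_pmf.expectation (bind_pmf p f) h =
    measure_pmf.expectation p (\<lambda>x. measure_pmf.expectation (f x) h)"
  using assms by (simp add: pmf_expectation_bind[of "set_pmf p"] integral_measure_pmf[of "set_pmf p"])

lemma expectation_mono_finite:
  fixes g h :: "'b \<Rightarrow> real"
  assumes "finite (set_pmf p)" "\<And>x. x \<in> set_pmf p \<Longrightarrow> g x \<le> h x"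
  shows "measure_pmf.expectation p g \<le> measure_pmf.expectation p h"
  using assms by (intro integral_mono_AE) (auto intro: integrable_measure_pmf_finite simp: AE_measure_pmf_iff)

definition valid :: "('i, 's) bandit \<Rightarrow> ('i, 's) config \<Rightarrow> bool" where
  "valid B c \<longleftrightarrow> (\<forall>i. state c i \<in> states B i \<and> elapsed c i \<ge> 1)"

lemma monotone_banditD:
  assumes "monotone_bandit B"
  shows "finite (states B i)" "states B i \<noteq> {}" "closing B i \<ge> 0" "setup_cost B i \<ge> 0"
    "k \<in> states B i \<Longrightarrow> reward B i k \<ge> 0"
    "k \<in> states B i \<Longrightarrow> j \<in> states B i \<Longrightarrow> rate B i k j \<ge> 0"
    "k \<in> states B i \<Longrightarrow> (\<Sum>j\<in>states B i - {k}. rate B i k j) \<le> 1"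
    "k \<in> states B i \<Longrightarrow> t \<ge> 1 \<Longrightarrow> ramp B i k t \<ge> 0"
    "k \<in> states B i \<Longrightarrow> t \<ge> 1 \<Longrightarrow> ramp B i k t \<le> 1"
    "k \<in> states B i \<Longrightarrow> s \<ge> 1 \<Longrightarrow> s \<le> t \<Longrightarrow> ramp B i k s \<le> ramp B i k t"
    "k \<in> states B i \<Longrightarrow> j \<in> states B i \<Longrightarrow> (j, k) \<in> (edges (states B i) (rate B i))\<^sup>*"
  using assms unfolding monotone_bandit_def edges_def mono_on_def by auto

lemma drift_eq_flow: "drift B D i k = flow (states B i) (rate B i) (pot D i) k"
  by (simp add: drift_def flow_def)

lemma set_move:
  assumes "monotone_bandit B" "k \<in> states B i" "t \<ge> 1"
  shows "set_pmf (move B i k t) \<subseteq> states B i"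
  using assms by (auto simp: set_pmf_iff pmf_move split: if_splits)

text \<open>This identifies the term \<open>ramp * drift\<close> of the dual constraints as the
  expected growth of \<open>pot\<close> at a play.\<close>

lemma expectation_move:
  assumes B: "monotone_bandit B" and k: "k \<in> states B i" and t: "t \<ge> 1"
  shows "measure_pmf.expectation (move B i k t) p =
    p k + ramp B i k t * flow (states B i) (rate B i) p k"
proof -
  let ?S = "states B i" and ?f = "ramp B i k t"
  have fin: "finite ?S" using monotone_banditD[OF B] by blast
  have "measure_pmf.expectation (move B i k t) p = (\<Sum>j\<in>?S. p j * pmf (move B i k t) j)"
    using fin set_move[OF B k t] by (intro integral_measure_pmf_real) auto
  also have "\<dots> = p k * (1 - (\<Sum>j\<in>?S - {k}. ?f * rate B i k j)) +
      (\<Sum>j\<in>?S - {k}. p j * (?f * rate B i k j))"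
    using fin k by (subst sum.remove[of _ k]) (auto simp: pmf_move[OF B k t] intro!: sum.cong)
  also have "\<dots> = p k + ?f * flow ?S (rate B i) p k"
    by (simp add: flow_def sum_distrib_left algebra_simps sum_subtractf)
  finally show ?thesis .
qed

lemma set_step_play:
  assumes B: "monotone_bandit B" and c: "valid B c" and c': "c' \<in> set_pmf (step B c (Some i))"
  shows "state c' i \<in> states B i" "j \<noteq> i \<Longrightarrow> state c' j = state c j"
    "elapsed c' j = (if j = i then 1 else Suc (elapsed c j))" "last_played c' = Some i"
  using c' c set_move[OF B, of "state c i" i "elapsed c i"]
  by (auto simp: step_def valid_def)

lemma step_None: "step B c None = return_pmf (c\<lparr>elapsed := \<lambda>j. Suc (elapsed c j)\<rparr>)"
  by (simp add: step_def)

lemma valid_step: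
  assumes B: "monotone_bandit B" and c: "valid B c" and c': "c' \<in> set_pmf (step B c a)"
  shows "valid B c'"
proof (cases a)
  case None
  then show ?thesis using c c' by (auto simp: step_None valid_def)
next
  case (Some i)
  then have c'': "c' \<in> set_pmf (step B c (Some i))" using c' by simp
  have "state c' j \<in> states B j" for j
    using set_step_play(1,2)[OF B c c''] c by (cases "j = i") (auto simp: valid_def)
  then show ?thesis
    using set_step_play(3)[OF B c c''] by (simp add: valid_def)
qed

lemma finite_step:
  assumes B: "monotone_bandit B" and c: "valid B c"
  shows "finite (set_pmf (step B c a))"
proof (cases a)
  case (Some i)
  have "finite (set_pmf (move B i (state c i) (elapsed c i)))"
    using set_move[OF B] c monotone_banditD(1)[OF B] by (metis finite_subset valid_def)
  then show ?thesis by (simp add: step_def Some)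
qed (simp add: step_None)

lemma expectation_step_play:
  fixes B :: "('i::finite, 's) bandit" and p :: "'i \<Rightarrow> 's \<Rightarrow> real"
  assumes B: "monotone_bandit B" and c: "valid B c"
  shows "measure_pmf.expectation (step B c (Some i)) (\<lambda>c'. \<Sum>j\<in>UNIV. p j (state c' j)) =
    (\<Sum>j\<in>UNIV. p j (state c j)) +
    ramp B i (state c i) (elapsed c i) * flow (states B i) (rate B i) (p i) (state c i)"
proof -
  let ?m = "move B i (state c i) (elapsed c i)" and ?R = "\<Sum>j\<in>UNIV - {i}. p j (state c j)"
  have ci: "state c i \<in> states B i" "elapsed c i \<ge> 1" using c by (auto simp: valid_def)
  have fin: "finite (set_pmf ?m)"
    using set_move[OF B ci] monotone_banditD(1)[OF B] by (metis finite_subset)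
  have "(\<Sum>j\<in>UNIV. p j (((state c)(i := k)) j)) = p i k + ?R" for k
    by (subst sum.remove[of _ i]) (auto intro!: sum.cong)
  then have "measure_pmf.expectation (step B c (Some i)) (\<lambda>c'. \<Sum>j\<in>UNIV. p j (state c' j)) =
      measure_pmf.expectation ?m (\<lambda>k. p i k + ?R)"
    by (simp add: step_def)
  also have "\<dots> = measure_pmf.expectation ?m (p i) + ?R"
    using fin by (simp add: integrable_measure_pmf_finite)
  also have "measure_pmf.expectation ?m (p i) = p i (state c i) +
      ramp B i (state c i) (elapsed c i) * flow (states B i) (rate B i) (p i) (state c i)"
    by (rule expectation_move[OF B ci])
  finally show ?thesis
    by (simp add: sum.remove[of UNIV i])
qed

text \<open>There are finitely many actions and each step has finite support, so every expectation
  over runs is a finite sum and integrability is automatic, although elapsed times are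
  unbounded.\<close>

lemma run_support:
  fixes B :: "('i::finite, 's) bandit"
  assumes B: "monotone_bandit B"
    and inv0: "I c0" and valid: "\<And>c. I c \<Longrightarrow> valid B c"
    and inv: "\<And>past c a c'. I c \<Longrightarrow> a \<in> set_pmf (\<pi> past c) \<Longrightarrow> c' \<in> set_pmf (step B c a) \<Longrightarrow> I c'"
  shows "finite (set_pmf (run B \<pi> c0 n)) \<and> (\<forall>x\<in>set_pmf (run B \<pi> c0 n). I (snd x))"
proof (induction n)
  case 0
  then show ?case using inv0 by simp
next
  case (Suc n)
  then have fin: "finite (set_pmf (run B \<pi> c0 n))"
    and I: "\<And>x. x \<in> set_pmf (run B \<pi> c0 n) \<Longrightarrow> I (snd x)" by auto
  have "finite (set_pmf (step B (snd x) a))" if "x \<in> set_pmf (run B \<pi> c0 n)" for x a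
    using finite_step[OF B valid[OF I[OF that]]] .
  then have "finite (set_pmf (run B \<pi> c0 (Suc n)))"
    using fin by (auto simp: split_beta)
  moreover have "I (snd x)" if "x \<in> set_pmf (run B \<pi> c0 (Suc n))" for x
  proof -
    from that obtain y a c' where "y \<in> set_pmf (run B \<pi> c0 n)" "a \<in> set_pmf (\<pi> (fst y) (snd y))"
      "c' \<in> set_pmf (step B (snd y) a)" "x = (fst y @ [(snd y, a)], c')"
      by (auto simp: split_beta)
    then show ?thesis using inv[OF I] by simp
  qed
  ultimately show ?case by blast
qed

text \<open>The sign \<open>\<sigma>\<close> serves lower bounds (\<open>\<sigma> = 1\<close>) and upper bounds (\<open>\<sigma> = -1\<close>) alike.\<close>

lemma average_drift:
  fixes B :: "('i::finite, 's) bandit" and \<Psi> :: "('i, 's) config \<Rightarrow> real" and \<sigma> :: real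
  assumes B: "monotone_bandit B"
    and inv0: "I c0" and valid: "\<And>c. I c \<Longrightarrow> valid B c"
    and inv: "\<And>past c a c'. I c \<Longrightarrow> a \<in> set_pmf (\<pi> past c) \<Longrightarrow> c' \<in> set_pmf (step B c a) \<Longrightarrow> I c'"
    and drift: "\<And>past c a. I c \<Longrightarrow> a \<in> set_pmf (\<pi> past c) \<Longrightarrow>
      \<sigma> * (payoff B c a + measure_pmf.expectation (step B c a) \<Psi>) \<ge> \<sigma> * (v + \<Psi> c)"
    and bound: "\<And>c. I c \<Longrightarrow> \<sigma> * \<Psi> c \<le> K"
    and T: "T > 0"
  shows "\<sigma> * average_payoff B \<pi> c0 T \<ge> \<sigma> * v - (K - \<sigma> * \<Psi> c0) / real T"
proof -
  define E where "E n = measure_pmf.expectation (run B \<pi> c0 n) (\<lambda>x. \<Psi> (snd x))" for n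
  have supp: "finite (set_pmf (run B \<pi> c0 n)) \<and> (\<forall>x\<in>set_pmf (run B \<pi> c0 n). I (snd x))" for n
    by (rule run_support; fact)
  have fin: "finite (set_pmf (run B \<pi> c0 n))" for n using supp by blast
  have I: "I (snd x)" if "x \<in> set_pmf (run B \<pi> c0 n)" for x n using supp that by blast
  have finstep: "finite (set_pmf (step B c a))" if "I c" for c a
    using finite_step[OF B valid[OF that]] .
  have int [simp]: "integrable (measure_pmf (run B \<pi> c0 n)) f" for n and f :: "_ \<Rightarrow> real"
    using fin by (rule integrable_measure_pmf_finite)
  have int' [simp]: "integrable (measure_pmf (\<pi> past c)) f" for past c and f :: "_ \<Rightarrow> real"
    by (rule integrable_measure_pmf_finite) simp
  have ESuc: "E (Suc n) = measure_pmf.expectation (run B \<pi> c0 n) (\<lambda>x.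
      measure_pmf.expectation (\<pi> (fst x) (snd x)) (\<lambda>a.
        measure_pmf.expectation (step B (snd x) a) \<Psi>))" for n
  proof -
    have "E (Suc n) = measure_pmf.expectation (run B \<pi> c0 n) (\<lambda>x.
      measure_pmf.expectation (bind_pmf (\<pi> (fst x) (snd x)) (\<lambda>a.
         map_pmf (\<lambda>c'. (fst x @ [(snd x, a)], c')) (step B (snd x) a))) (\<lambda>x. \<Psi> (snd x)))"
      unfolding E_def run.simps case_prod_beta
      using fin I finstep by (subst expectation_bind_finite) auto
    also have "\<dots> = measure_pmf.expectation (run B \<pi> c0 n) (\<lambda>x.
      measure_pmf.expectation (\<pi> (fst x) (snd x)) (\<lambda>a.
        measure_pmf.expectation (step B (snd x) a) \<Psi>))"
      using I finstep
      by (intro integral_cong_AE) (auto simp: AE_measure_pmf_iff expectation_bind_finite)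
    finally show ?thesis .
  qed
  have pay: "expected_payoff B \<pi> c0 n = measure_pmf.expectation (run B \<pi> c0 n) (\<lambda>x.
      measure_pmf.expectation (\<pi> (fst x) (snd x)) (payoff B (snd x)))" for n
    unfolding expected_payoff_def case_prod_beta
    using fin by (subst expectation_bind_finite) auto
  have one: "\<sigma> * (expected_payoff B \<pi> c0 n + E (Suc n)) \<ge> \<sigma> * (v + E n)" for n
  proof -
    have "\<sigma> * (v + E n) = measure_pmf.expectation (run B \<pi> c0 n) (\<lambda>x. \<sigma> * (v + \<Psi> (snd x)))"
      by (simp add: E_def)
    also have "\<dots> \<le> measure_pmf.expectation (run B \<pi> c0 n) (\<lambda>x.
      measure_pmf.expectation (\<pi> (fst x) (snd x)) (\<lambda>a. \<sigma> * (payoff B (snd x) a +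
        measure_pmf.expectation (step B (snd x) a) \<Psi>)))"
    proof (rule expectation_mono_finite[OF fin])
      fix x assume x: "x \<in> set_pmf (run B \<pi> c0 n)"
      have "\<sigma> * (v + \<Psi> (snd x)) =
        measure_pmf.expectation (\<pi> (fst x) (snd x)) (\<lambda>_. \<sigma> * (v + \<Psi> (snd x)))" by simp
      also have "\<dots> \<le> measure_pmf.expectation (\<pi> (fst x) (snd x)) (\<lambda>a. \<sigma> * (payoff B (snd x) a +
        measure_pmf.expectation (step B (snd x) a) \<Psi>))"
        using drift[OF I[OF x]] by (intro expectation_mono_finite) auto
      finally show "\<sigma> * (v + \<Psi> (snd x)) \<le> \<dots>" .
    qed
    also have "\<dots> = \<sigma> * (expected_payoff B \<pi> c0 n + E (Suc n))"
      by (simp add: pay ESuc)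
    finally show ?thesis .
  qed
  \<comment> \<open>Telescoping of \<open>one\<close>; this \<open>T\<close> is bound afresh so that
    the induction can start at 0.\<close>
  have "\<sigma> * ((\<Sum>n<T. expected_payoff B \<pi> c0 n) + E T) \<ge> \<sigma> * (real T * v + E 0)" for T
  proof (induction T)
    case (Suc T)
    then show ?case using one[of T] by (simp add: algebra_simps)
  qed simp
  from this[of T] have "\<sigma> * (\<Sum>n<T. expected_payoff B \<pi> c0 n) \<ge> \<sigma> * (real T * v) + \<sigma> * \<Psi> c0 - \<sigma> * E T"
    by (simp add: algebra_simps E_def)
  moreover have "\<sigma> * E T \<le> K"
  proof -
    have "\<sigma> * E T = measure_pmf.expectation (run B \<pi> c0 T) (\<lambda>x. \<sigma> * \<Psi> (snd x))"
      by (simp add: E_def)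
    also have "\<dots> \<le> measure_pmf.expectation (run B \<pi> c0 T) (\<lambda>_. K)"
      using bound I by (intro expectation_mono_finite[OF fin]) auto
    finally show ?thesis by simp
  qed
  ultimately have "\<sigma> * (\<Sum>n<T. expected_payoff B \<pi> c0 n) \<ge> \<sigma> * (real T * v) - (K - \<sigma> * \<Psi> c0)"
    by simp
  then have "(\<sigma> * (real T * v) - (K - \<sigma> * \<Psi> c0)) / real T
      \<le> \<sigma> * (\<Sum>n<T. expected_payoff B \<pi> c0 n) / real T"
    by (rule divide_right_mono) simp
  then show ?thesis
    using T by (simp add: average_payoff_def diff_divide_distrib)
qed

text \<open>The boundary term \<open>(K - \<Psi> c0) / T\<close> vanishes in the limit. A one-sided
  bound on \<open>\<Psi>\<close> suffices because the start is fixed and only the final potential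
  varies.\<close>

lemma lower_value_ge:
  fixes B :: "('i::finite, 's) bandit" and \<Psi> :: "('i, 's) config \<Rightarrow> real"
  assumes B: "monotone_bandit B"
    and inv0: "I c0" and valid: "\<And>c. I c \<Longrightarrow> valid B c"
    and inv: "\<And>past c a c'. I c \<Longrightarrow> a \<in> set_pmf (\<pi> past c) \<Longrightarrow> c' \<in> set_pmf (step B c a) \<Longrightarrow> I c'"
    and drift: "\<And>past c a. I c \<Longrightarrow> a \<in> set_pmf (\<pi> past c) \<Longrightarrow>
      payoff B c a + measure_pmf.expectation (step B c a) \<Psi> \<ge> v + \<Psi> c"
    and bound: "\<And>c. I c \<Longrightarrow> \<Psi> c \<le> K"
  shows "lower_value B \<pi> c0 \<ge> ereal v"
proof -
  have "v - (K - \<Psi> c0) / real T \<le> average_payoff B \<pi> c0 T" if "T > 0" for T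
  proof -
    have "1 * v - (K - 1 * \<Psi> c0) / real T \<le> 1 * average_payoff B \<pi> c0 T"
      by (rule average_drift[where I = I and \<Psi> = \<Psi>]; (fact | use drift bound in simp))
    then show ?thesis by simp
  qed
  then have "eventually (\<lambda>T. ereal (v - (K - \<Psi> c0) / real T) \<le> ereal (average_payoff B \<pi> c0 T)) sequentially"
    by (intro eventually_sequentiallyI[of 1]) simp
  then have "liminf (\<lambda>T. ereal (v - (K - \<Psi> c0) / real T)) \<le> lower_value B \<pi> c0"
    unfolding lower_value_def by (rule Liminf_mono)
  moreover have "(\<lambda>T. v - (K - \<Psi> c0) / real T) \<longlonglongrightarrow> v - 0"
    by (intro tendsto_diff tendsto_const lim_const_over_n)
  then have "(\<lambda>T. ereal (v - (K - \<Psi> c0) / real T)) \<longlonglongrightarrow> ereal v" by simp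
  ultimately show ?thesis by (simp only: lim_imp_Liminf[OF sequentially_bot])
qed

lemma upper_value_le:
  fixes B :: "('i::finite, 's) bandit" and \<Psi> :: "('i, 's) config \<Rightarrow> real"
  assumes B: "monotone_bandit B"
    and inv0: "I c0" and valid: "\<And>c. I c \<Longrightarrow> valid B c"
    and inv: "\<And>past c a c'. I c \<Longrightarrow> a \<in> set_pmf (\<pi> past c) \<Longrightarrow> c' \<in> set_pmf (step B c a) \<Longrightarrow> I c'"
    and drift: "\<And>past c a. I c \<Longrightarrow> a \<in> set_pmf (\<pi> past c) \<Longrightarrow>
      payoff B c a + measure_pmf.expectation (step B c a) \<Psi> \<le> v + \<Psi> c"
    and bound: "\<And>c. I c \<Longrightarrow> K \<le> \<Psi> c"
  shows "upper_value B \<pi> c0 \<le> ereal v"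
proof -
  have drift': "- 1 * (v + \<Psi> c) \<le> - 1 * (payoff B c a + measure_pmf.expectation (step B c a) \<Psi>)"
    if "I c" "a \<in> set_pmf (\<pi> past c)" for past c a
    using drift[OF that] by (simp add: algebra_simps)
  have "average_payoff B \<pi> c0 T \<le> v + (- K + \<Psi> c0) / real T" if "T > 0" for T
  proof -
    have "- 1 * v - (- K - (- 1) * \<Psi> c0) / real T \<le> - 1 * average_payoff B \<pi> c0 T"
      by (rule average_drift[where I = I and \<Psi> = \<Psi>]; (fact | use bound in simp))
    then show ?thesis by (simp add: diff_divide_distrib add_divide_distrib)
  qed
  then have "eventually (\<lambda>T. ereal (average_payoff B \<pi> c0 T) \<le> ereal (v + (- K + \<Psi> c0) / real T)) sequentially"
    by (intro eventually_sequentiallyI[of 1]) simp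
  then have "upper_value B \<pi> c0 \<le> limsup (\<lambda>T. ereal (v + (- K + \<Psi> c0) / real T))"
    unfolding upper_value_def by (rule Limsup_mono)
  moreover have "(\<lambda>T. v + (- K + \<Psi> c0) / real T) \<longlonglongrightarrow> v + 0"
    by (intro tendsto_add tendsto_const lim_const_over_n)
  then have "(\<lambda>T. ereal (v + (- K + \<Psi> c0) / real T)) \<longlonglongrightarrow> ereal v" by simp
  ultimately show ?thesis by (simp only: lim_imp_Limsup[OF sequentially_bot])
qed

text \<open>The part of the potential that depends on the arm states grows by a known amount; the
  rest, \<open>g\<close>, is estimated outcome by outcome. An inequality suits the index policy,
  where the banks of unplayed arms are only known not to shrink.\<close>

lemma expectation_step_play_ge:
  fixes B :: "('i::finite, 's) bandit" and p :: "'i \<Rightarrow> 's \<Rightarrow> real"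
  assumes B: "monotone_bandit B" and c: "valid B c"
    and G: "\<And>c'. c' \<in> set_pmf (step B c (Some i)) \<Longrightarrow> G \<le> g c'"
  shows "(\<Sum>j\<in>UNIV. p j (state c j)) +
      ramp B i (state c i) (elapsed c i) * flow (states B i) (rate B i) (p i) (state c i) + G \<le>
    measure_pmf.expectation (step B c (Some i)) (\<lambda>c'. (\<Sum>j\<in>UNIV. p j (state c' j)) + g c')"
proof -
  note [simp] = integrable_measure_pmf_finite[OF finite_step[OF B c]]
  have "measure_pmf.expectation (step B c (Some i)) (\<lambda>c'. (\<Sum>j\<in>UNIV. p j (state c' j)) + G) \<le>
    measure_pmf.expectation (step B c (Some i)) (\<lambda>c'. (\<Sum>j\<in>UNIV. p j (state c' j)) + g c')"
    using G by (intro expectation_mono_finite finite_step[OF B c]) auto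
  then show ?thesis by (simp add: expectation_step_play[OF B c])
qed

lemma expectation_step_play_eq:
  fixes B :: "('i::finite, 's) bandit" and p :: "'i \<Rightarrow> 's \<Rightarrow> real"
  assumes B: "monotone_bandit B" and c: "valid B c"
    and G: "\<And>c'. c' \<in> set_pmf (step B c (Some i)) \<Longrightarrow> g c' = G"
  shows "measure_pmf.expectation (step B c (Some i)) (\<lambda>c'. (\<Sum>j\<in>UNIV. p j (state c' j)) + g c') =
    (\<Sum>j\<in>UNIV. p j (state c j)) +
      ramp B i (state c i) (elapsed c i) * flow (states B i) (rate B i) (p i) (state c i) + G"
proof -
  note [simp] = integrable_measure_pmf_finite[OF finite_step[OF B c]]
  have "measure_pmf.expectation (step B c (Some i)) (\<lambda>c'. (\<Sum>j\<in>UNIV. p j (state c' j)) + g c') =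
    measure_pmf.expectation (step B c (Some i)) (\<lambda>c'. (\<Sum>j\<in>UNIV. p j (state c' j)) + G)"
    using G by (intro integral_cong_AE) (auto simp: AE_measure_pmf_iff)
  then show ?thesis by (simp add: expectation_step_play[OF B c])
qed

section \<open>Weak duality\<close>

lemma dual_feasibleD:
  assumes "dual_feasible B D"
  shows "k \<in> states B i \<Longrightarrow> t \<ge> 1 \<Longrightarrow> reward B i k - closing B i - setup_cost B i +
      ramp B i k t * drift B D i k \<le> lam D + real t * hval D i"
    "k \<in> states B i \<Longrightarrow> t \<ge> 1 \<Longrightarrow> reward B i k + ramp B i k t * drift B D i k \<le> real t * (lam D + hval D i)"
    "lam D = (\<Sum>i\<in>UNIV. hval D i)" "lam D \<ge> 0" "hval D i \<ge> 0"
  using assms by (auto simp: dual_feasible_def switch_lhs_def switch_rhs_def stay_lhs_def stay_rhs_def)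

lemma finite_potential_bounds:
  fixes B :: "('i::finite, 's) bandit"
  assumes "monotone_bandit B"
  shows "\<exists>L. \<forall>c. valid B c \<longrightarrow> \<bar>\<Sum>i\<in>UNIV. p i (state c i)\<bar> \<le> (L::real)"
proof -
  have "\<bar>\<Sum>i\<in>UNIV. p i (state c i)\<bar> \<le> (\<Sum>i\<in>UNIV. \<Sum>k\<in>states B i. \<bar>p i k\<bar>)" if "valid B c" for c
  proof -
    have "\<bar>\<Sum>i\<in>UNIV. p i (state c i)\<bar> \<le> (\<Sum>i\<in>UNIV. \<bar>p i (state c i)\<bar>)" by (rule sum_abs)
    also have "\<dots> \<le> (\<Sum>i\<in>UNIV. \<Sum>k\<in>states B i. \<bar>p i k\<bar>)"
      using that monotone_banditD(1)[OF assms]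
      by (intro sum_mono member_le_sum) (auto simp: valid_def)
    finally show ?thesis .
  qed
  then show ?thesis by blast
qed

lemma upper_value_le_dual:
  fixes B :: "('i::finite, 's) bandit"
  assumes B: "monotone_bandit B" and D: "dual_feasible B D" and c0: "c0 \<in> starts B"
  shows "upper_value B \<pi> c0 \<le> ereal (dual_objective D)"
proof -
  let ?S = "\<Sum>j\<in>UNIV. setup_cost B j" and ?H = "\<Sum>j\<in>UNIV. hval D j"
  define \<Phi> where "\<Phi> c = (\<Sum>j\<in>UNIV. pot D j (state c j))" for c :: "('i, 's) config"
  \<comment> \<open>An idle period of the last played arm banks \<open>lam\<close> per step, every arm banks its \<open>hval\<close> per
    step, and the closing cost is charged when an arm is taken up.\<close>
  define g where "g c = (\<Sum>j\<in>UNIV. hval D j * real (elapsed c j)) +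
      lam D * (case last_played c of None \<Rightarrow> 1 | Some l \<Rightarrow> real (elapsed c l)) -
      (case last_played c of None \<Rightarrow> - ?S | Some l \<Rightarrow> closing B l)" for c :: "('i, 's) config"
  note dual = dual_feasibleD[OF D]
  note mb = monotone_banditD[OF B]
  obtain L where L: "\<And>c. valid B c \<Longrightarrow> \<bar>\<Phi> c\<bar> \<le> L"
    using finite_potential_bounds[OF B, of "pot D"] unfolding \<Phi>_def by blast
  show ?thesis
  proof (rule upper_value_le[where I = "valid B" and \<Psi> = "\<lambda>c. \<Phi> c + g c"
        and K = "- L - (\<Sum>j\<in>UNIV. closing B j)"])
    show "monotone_bandit B" by fact
    show "valid B c0" using c0 by (simp add: starts_def valid_def)
    show "valid B c" if "valid B c" for c by fact
    show "valid B c'" if "valid B c" "a \<in> set_pmf (\<pi> past c)" "c' \<in> set_pmf (step B c a)" for past c a c'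
      using valid_step[OF B] that by blast
  next
    fix c :: "('i, 's) config" assume c: "valid B c"
    have "0 \<le> (\<Sum>j\<in>UNIV. hval D j * real (elapsed c j))"
      using dual(5) by (intro sum_nonneg) simp
    moreover have "0 \<le> lam D * (case last_played c of None \<Rightarrow> 1 | Some l \<Rightarrow> real (elapsed c l))"
      using dual(4) by (simp split: option.split)
    moreover have "(case last_played c of None \<Rightarrow> - ?S | Some l \<Rightarrow> closing B l) \<le> (\<Sum>j\<in>UNIV. closing B j)"
    proof (cases "last_played c")
      case None
      have "0 \<le> ?S" "0 \<le> (\<Sum>j\<in>UNIV. closing B j)" using mb by (auto intro: sum_nonneg)
      then show ?thesis using None by simp
    next
      case (Some l)
      then show ?thesis using mb by (auto intro: member_le_sum)
    qed
    ultimately show "- L - (\<Sum>j\<in>UNIV. closing B j) \<le> \<Phi> c + g c"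
      using L[OF c] unfolding g_def by linarith
  next
    fix past a and c :: "('i, 's) config" assume c: "valid B c"
    show "payoff B c a + measure_pmf.expectation (step B c a) (\<lambda>c. \<Phi> c + g c)
        \<le> dual_objective D + (\<Phi> c + g c)"
    proof (cases a)
      case None
      have "(\<Sum>j\<in>UNIV. hval D j * real (Suc (elapsed c j))) =
          (\<Sum>j\<in>UNIV. hval D j * real (elapsed c j)) + ?H"
        by (simp add: sum.distrib algebra_simps)
      then show ?thesis
        using dual(4) None
        by (simp add: step_None payoff_def \<Phi>_def g_def dual_objective_def algebra_simps split: option.split)
    next
      case (Some i)
      define k t where "k = state c i" and "t = elapsed c i"
      have kt: "k \<in> states B i" "t \<ge> 1" using c by (auto simp: valid_def k_def t_def)
      have sum_t: "(\<Sum>j\<in>UNIV. hval D j * real (if j = i then 1 else Suc (elapsed c j))) =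
          (\<Sum>j\<in>UNIV. hval D j * real (elapsed c j)) + ?H - real t * hval D i"
        by (simp add: sum.remove[of UNIV i] sum.distrib algebra_simps t_def)
      define G where "G = (\<Sum>j\<in>UNIV. hval D j * real (elapsed c j)) + ?H - real t * hval D i
        + lam D - closing B i"
      have "g c' = G" if "c' \<in> set_pmf (step B c (Some i))" for c'
        using set_step_play[OF B c that] sum_t unfolding g_def G_def by simp
      then have E: "measure_pmf.expectation (step B c a) (\<lambda>c. \<Phi> c + g c) =
          \<Phi> c + ramp B i k t * drift B D i k + G"
        unfolding \<Phi>_def Some k_def t_def drift_eq_flow
        by (rule expectation_step_play_eq[OF B c])
      \<comment> \<open>The first play pays no switching cost, yet it is charged to the switching
        constraint. The credit \<open>?S\<close> that \<open>g\<close> gives up at that play takes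
        the place of the setup cost, whichever arm is chosen.\<close>
      have setup_le: "setup_cost B i \<le> ?S" using mb by (auto intro: member_le_sum)
      show ?thesis
      proof (cases "last_played c")
        case None
        then show ?thesis
          using dual(1)[OF kt] setup_le E
          by (simp add: Some payoff_def g_def G_def switching_cost_def dual_objective_def k_def)
      next
        case (Some l)
        show ?thesis
        proof (cases "l = i")
          case True
          then show ?thesis
            using dual(2)[OF kt] E \<open>a = Some i\<close> Some
            by (simp add: payoff_def g_def G_def switching_cost_def dual_objective_def k_def t_def algebra_simps)
        next
          case False
          \<comment> \<open>The closing cost of \<open>l\<close> was already subtracted in
            \<open>g\<close>, so the switch amounts to both costs of \<open>i\<close>. Of the
            \<open>lam\<close> banked since \<open>l\<close> was played, one unit carries over to
            \<open>i\<close> and the rest is lost, in the favourable direction.\<close>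
          have "lam D \<le> lam D * real (elapsed c l)"
            using c dual(4) by (simp add: valid_def mult_le_cancel_left1)
          then show ?thesis
            using dual(1)[OF kt] E \<open>a = Some i\<close> Some False
            by (simp add: payoff_def g_def G_def switching_cost_def dual_objective_def k_def)
        qed
      qed
    qed
  qed
qed

lemma optimal_value_le:
  fixes B :: "('i::finite, 's) bandit"
  assumes "monotone_bandit B" "dual_feasible B D"
  shows "optimal_value B / 2 \<le> ereal (lam D)"
proof -
  have "optimal_value B \<le> ereal (dual_objective D)"
    unfolding optimal_value_def using upper_value_le_dual[OF assms] by (intro SUP_least)
  also have "dual_objective D = 2 * lam D"
    using dual_feasibleD(3)[OF assms(2)] by (simp add: dual_objective_def)
  finally have "optimal_value B / 2 \<le> ereal (2 * lam D) / 2"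
    by (intro ereal_divide_right_mono) auto
  then show ?thesis by simp
qed

section \<open>The index policy\<close>

definition all_tight :: "('i, 's) bandit \<Rightarrow> ('i, 's) dual \<Rightarrow> bool" where
  "all_tight B D \<longleftrightarrow> (\<forall>i. hval D i > 0 \<longrightarrow> \<not> never_tight B D i)"

lemma first_tight:
  assumes "all_tight B D" "hval D i > 0" "k \<in> states B i"
  shows "first_tight B D i k \<ge> 1" "tight B D i k (first_tight B D i k)"
proof -
  obtain t where "t \<ge> 1 \<and> tight B D i k t"
    using assms by (auto simp: all_tight_def never_tight_def)
  from LeastI[of "\<lambda>t. t \<ge> 1 \<and> tight B D i k t", OF this]
  show "first_tight B D i k \<ge> 1" "tight B D i k (first_tight B D i k)"
    by (simp_all add: first_tight_def)
qed

lemma good_tight: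
  assumes "k \<in> good_states B D i"
  shows "real (first_tight B D i k) * (lam D + hval D i) =
    reward B i k + ramp B i k (first_tight B D i k) * drift B D i k"
  using assms by (simp add: good_states_def stay_lhs_def stay_rhs_def Let_def)

text \<open>For negative drift both left-hand sides exceed the right-hand sides strictly once \<open>t > 1\<close>,
  and a switching constraint that is tight at \<open>t = 1\<close> forces the staying constraint to be tight.\<close>

lemma index_tight:
  assumes B: "monotone_bandit B" and D: "dual_feasible B D" and tight: "all_tight B D"
    and h: "hval D i > 0" and k: "k \<in> index_states B D i"
  defines "t \<equiv> first_tight B D i k"
  shows "lam D + real t * hval D i =
      reward B i k - closing B i - setup_cost B i + ramp B i k t * drift B D i k"
    and "drift B D i k \<ge> 0"
proof -
  note mb = monotone_banditD[OF B] and dual = dual_feasibleD[OF D]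
  have kS: "k \<in> states B i" using k by (simp add: index_states_def)
  have t1: "t \<ge> 1" and tt: "tight B D i k t"
    using first_tight[OF tight h kS] by (simp_all add: t_def)
  have nstay: "real t * (lam D + hval D i) \<noteq> reward B i k + ramp B i k t * drift B D i k"
    using k kS by (auto simp: index_states_def good_states_def t_def stay_lhs_def stay_rhs_def)
  then show eq: "lam D + real t * hval D i =
      reward B i k - closing B i - setup_cost B i + ramp B i k t * drift B D i k"
    using tt by (simp add: tight_def switch_lhs_def switch_rhs_def stay_lhs_def stay_rhs_def)
  show "drift B D i k \<ge> 0"
  proof (rule ccontr)
    assume neg: "\<not> drift B D i k \<ge> 0"
    have "ramp B i k t * drift B D i k \<le> ramp B i k 1 * drift B D i k"
      using mb(10)[OF kS _ t1] neg by (simp add: mult_right_mono_neg)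
    then have "lam D + real t * hval D i \<le> lam D + hval D i"
      using eq dual(1)[OF kS, of 1] by simp
    then have "t = 1" using h t1 by (simp add: mult_le_cancel_right1)
    then show False
      using nstay eq dual(2)[OF kS, of 1] mb(3,4)[of i] by simp
  qed
qed

text \<open>In \<open>m - 1\<close> the missing unit of \<open>lam\<close> is the amount owed for
  the step of the play itself. At the first tight time \<open>t0\<close> that amount together with
  the bank is \<open>t0 * (lam + hval)\<close> in a good state and \<open>lam + t0 * hval\<close>
  otherwise: the left-hand sides of the staying and the switching constraint.\<close>

definition bank :: "('i, 's) bandit \<Rightarrow> ('i, 's) dual \<Rightarrow> ('i, 's) config \<Rightarrow> 'i \<Rightarrow> real" where
  "bank B D c i = (let m = real (min (elapsed c i) (first_tight B D i (state c i))) in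
     hval D i * m + (if i \<in> good_arms B D c then lam D * (m - 1) else 0))"

text \<open>By the choice of \<^const>\<open>stick_arms\<close> an arm of this set is in its initial state.\<close>

definition stale :: "('i, 's) bandit \<Rightarrow> ('i, 's) dual \<Rightarrow> ('i, 's) config \<Rightarrow> 'i set" where
  "stale B D c = {i \<in> good_arms B D c. last_played c \<noteq> Some i}"

text \<open>Together with being due, this forces a sticking arm to be played exactly at its first
  tight time. Precision matters there because the drift in a good state may be negative.\<close>

definition index_invariant :: "('i, 's) bandit \<Rightarrow> ('i, 's) dual \<Rightarrow> ('i, 's) config \<Rightarrow> bool" where
  "index_invariant B D c \<longleftrightarrow> valid B c \<and>
     (\<forall>i\<in>good_arms B D c. last_played c = Some i \<longrightarrow>
        elapsed c i \<le> first_tight B D i (state c i))"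

lemma bank_mono:
  assumes "dual_feasible B D" "state c' i = state c i" "elapsed c i \<le> elapsed c' i"
  shows "bank B D c i \<le> bank B D c' i"
proof -
  have "real (min (elapsed c i) (first_tight B D i (state c i))) \<le>
      real (min (elapsed c' i) (first_tight B D i (state c i)))"
    using assms by simp
  then show ?thesis
    using assms dual_feasibleD(4,5)[OF assms(1)]
    unfolding bank_def good_arms_def Let_def by (auto intro!: add_mono mult_left_mono)
qed

lemma bank_idle:
  assumes "\<not> due B D c i" "c' = c\<lparr>elapsed := \<lambda>j. Suc (elapsed c j)\<rparr>"
  shows "bank B D c' i = bank B D c i + hval D i + (if i \<in> good_arms B D c then lam D else 0)"
  using assms unfolding bank_def good_arms_def due_def Let_def
  by (auto simp: min_def algebra_simps not_le)

lemma index_actions_None: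
  assumes "None \<in> index_actions B D c"
  obtains i where "i \<in> good_arms B D c" "\<not> due B D c i"
      "\<And>l. last_played c = Some l \<Longrightarrow> l \<in> good_arms B D c \<Longrightarrow> i = l"
  | "good_arms B D c = {}" "ready_arms B D c = {}"
  using assms unfolding index_actions_def stick_arms_def
  by (auto split: if_splits)

text \<open>The cases are: sticking with the last played arm, taking up a stale arm, playing a ready
  arm in an index state.\<close>

lemma index_actions_Some:
  assumes "Some i \<in> index_actions B D c"
  obtains "i \<in> good_arms B D c" "due B D c i" "last_played c = Some i"
  | "i \<in> good_arms B D c" "due B D c i" "stale B D c = good_arms B D c"
  | "good_arms B D c = {}" "i \<in> ready_arms B D c"
  using assms unfolding index_actions_def stick_arms_def stale_def
  by (auto split: if_splits)

lemma index_actions_nonempty: "index_actions B D c \<noteq> {}"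
  unfolding index_actions_def by (simp only: image_is_empty split: if_split) simp

lemma index_lower_value:
  fixes B :: "('i::finite, 's) bandit"
  assumes B: "monotone_bandit B" and D: "dual_feasible B D" and tight: "all_tight B D"
    and \<pi>: "\<And>past c. set_pmf (\<pi> past c) \<subseteq> index_actions B D c" and c0: "c0 \<in> starts B"
  shows "lower_value B \<pi> c0 \<ge> ereal (lam D)"
proof -
  note mb = monotone_banditD[OF B] and dual = dual_feasibleD[OF D]
  \<comment> \<open>\<open>K\<close> covers whatever can be lost when a stale arm is taken up: both
    of its costs and, as ramps lie between 0 and 1, at most \<open>\<bar>drift\<bar>\<close> for a
    late play.\<close>
  define K where "K = (\<Sum>i\<in>UNIV. closing B i + setup_cost B i + (\<Sum>k\<in>states B i. \<bar>drift B D i k\<bar>))"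
  have K: "closing B i + setup_cost B i + \<bar>drift B D i k\<bar> \<le> K" if "k \<in> states B i" for i k
  proof -
    have "\<bar>drift B D i k\<bar> \<le> (\<Sum>k\<in>states B i. \<bar>drift B D i k\<bar>)"
      using mb that by (intro member_le_sum) auto
    then have "closing B i + setup_cost B i + \<bar>drift B D i k\<bar> \<le>
        closing B i + setup_cost B i + (\<Sum>k\<in>states B i. \<bar>drift B D i k\<bar>)" by simp
    also have "\<dots> \<le> K"
      unfolding K_def using mb by (intro member_le_sum) (auto intro!: add_nonneg_nonneg sum_nonneg)
    finally show ?thesis .
  qed
  have K0: "K \<ge> 0"
    unfolding K_def using mb by (auto intro!: add_nonneg_nonneg sum_nonneg)
  define \<Phi> where "\<Phi> c = (\<Sum>j\<in>UNIV. pot D j (state c j))" for c :: "('i, 's) config"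
  define g where "g c = (\<Sum>j\<in>UNIV. bank B D c j) - case_option 0 (closing B) (last_played c)
    - K * real (card (stale B D c))" for c
  obtain L where L: "\<And>c. valid B c \<Longrightarrow> \<bar>\<Phi> c\<bar> \<le> L"
    using finite_potential_bounds[OF B, of "pot D"] unfolding \<Phi>_def by blast
  \<comment> \<open>\<open>first_tight\<close> is some fixed number for every state, even where no
    constraint is tight and \<open>LEAST\<close> is arbitrary, so finiteness of the state sets
    bounds it.\<close>
  obtain M where M: "\<And>c. valid B c \<Longrightarrow>
      \<bar>\<Sum>i\<in>UNIV. (hval D i + lam D) * real (first_tight B D i (state c i))\<bar> \<le> M"
    using finite_potential_bounds[OF B, of "\<lambda>i k. (hval D i + lam D) * real (first_tight B D i k)"] by blast
  have bank_le: "bank B D c i \<le> (hval D i + lam D) * real (first_tight B D i (state c i))" for c i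
  proof -
    let ?m = "real (min (elapsed c i) (first_tight B D i (state c i)))"
    have "bank B D c i \<le> hval D i * ?m + lam D * ?m"
      using dual by (auto simp: bank_def Let_def algebra_simps)
    also have "\<dots> = (hval D i + lam D) * ?m" by (simp add: algebra_simps)
    also have "\<dots> \<le> (hval D i + lam D) * real (first_tight B D i (state c i))"
      using dual by (intro mult_left_mono) auto
    finally show ?thesis .
  qed
  have good_state: "state c i \<in> good_states B D i" "hval D i > 0" if "i \<in> good_arms B D c" for c i
    using that by (simp_all add: good_arms_def)
  show ?thesis
  proof (rule lower_value_ge[where I = "index_invariant B D" and \<Psi> = "\<lambda>c. \<Phi> c + g c" and K = "L + M"])
    show "monotone_bandit B" by fact
    show "index_invariant B D c0"
      using c0 by (simp add: index_invariant_def starts_def valid_def)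
    show "valid B c" if "index_invariant B D c" for c
      using that by (simp add: index_invariant_def)
  next
    fix past c a c'
    assume I: "index_invariant B D c" and a: "a \<in> set_pmf (\<pi> past c)"
      and c': "c' \<in> set_pmf (step B c a)"
    have c: "valid B c" using I by (simp add: index_invariant_def)
    have v': "valid B c'" using valid_step[OF B c c'] .
    show "index_invariant B D c'"
    proof (cases a)
      case None
      then have c'_eq: "c' = c\<lparr>elapsed := \<lambda>j. Suc (elapsed c j)\<rparr>" using c' by (simp add: step_None)
      have "None \<in> index_actions B D c" using a \<pi> None by blast
      then have "elapsed c l < first_tight B D l (state c l)"
        if "l \<in> good_arms B D c" "last_played c = Some l" for l
        using that by (cases rule: index_actions_None) (auto simp: due_def)
      moreover have "good_arms B D c' = good_arms B D c" by (simp add: good_arms_def c'_eq)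
      ultimately show ?thesis
        using v' unfolding index_invariant_def by (auto simp: c'_eq Suc_le_eq)
    next
      case (Some i)
      then have st: "last_played c' = Some i" "elapsed c' i = 1"
        using set_step_play[OF B c, of c' i] c' by auto
      have "1 \<le> first_tight B D i (state c' i)" if "i \<in> good_arms B D c'"
        using that v' first_tight(1)[OF tight] by (simp add: good_arms_def valid_def)
      then show ?thesis
        using v' st unfolding index_invariant_def by auto
    qed
  next
    fix c assume "index_invariant B D c"
    then have c: "valid B c" by (simp add: index_invariant_def)
    have "(\<Sum>j\<in>UNIV. bank B D c j) \<le> M"
      using sum_mono[of UNIV "bank B D c", OF bank_le] M[OF c] by (meson abs_le_D1 order_trans)
    moreover have "0 \<le> case_option 0 (closing B) (last_played c)"
      using mb by (simp split: option.split)
    moreover have "0 \<le> K * real (card (stale B D c))" using K0 by simp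
    ultimately show "\<Phi> c + g c \<le> L + M"
      using L[OF c] unfolding g_def by linarith
  next
    fix past c a
    assume I: "index_invariant B D c" and a: "a \<in> set_pmf (\<pi> past c)"
    have c: "valid B c" using I by (simp add: index_invariant_def)
    have act: "a \<in> index_actions B D c" using a \<pi> by blast
    show "lam D + (\<Phi> c + g c) \<le> payoff B c a + measure_pmf.expectation (step B c a) (\<lambda>c. \<Phi> c + g c)"
    proof (cases a)
      case None
      define c' where "c' = c\<lparr>elapsed := \<lambda>j. Suc (elapsed c j)\<rparr>"
      have mono: "bank B D c j \<le> bank B D c' j" for j
        by (rule bank_mono[OF D]) (simp_all add: c'_def)
      have "(\<Sum>j\<in>UNIV. bank B D c j) + lam D \<le> (\<Sum>j\<in>UNIV. bank B D c' j)"
        using act unfolding None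
      proof (cases rule: index_actions_None)
        case (1 i)
        have "(\<Sum>j\<in>UNIV. bank B D c j) + lam D \<le> (\<Sum>j\<in>UNIV - {i}. bank B D c j) + bank B D c' i"
          using bank_idle[OF 1(2) c'_def] 1(1) dual(5)[of i] by (simp add: sum.remove[of UNIV i])
        also have "\<dots> \<le> (\<Sum>j\<in>UNIV - {i}. bank B D c' j) + bank B D c' i"
          using mono by (intro add_right_mono sum_mono)
        finally show ?thesis by (simp add: sum.remove[of UNIV i])
      next
        case 2
        have "bank B D c j + hval D j \<le> bank B D c' j" for j
        proof (cases "hval D j > 0")
          case True
          then have "\<not> due B D c j"
            using 2 c by (auto simp: good_arms_def ready_arms_def index_states_def valid_def)
          then show ?thesis using bank_idle[OF _ c'_def] 2 by simp
        next
          case False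
          then show ?thesis using mono[of j] by simp
        qed
        then have "(\<Sum>j\<in>UNIV. bank B D c j + hval D j) \<le> (\<Sum>j\<in>UNIV. bank B D c' j)"
          by (intro sum_mono)
        then show ?thesis by (simp add: sum.distrib dual(3))
      qed
      moreover have "\<Phi> c' = \<Phi> c" "last_played c' = last_played c" "stale B D c' = stale B D c"
        by (simp_all add: \<Phi>_def c'_def stale_def good_arms_def)
      ultimately show ?thesis
        by (simp add: None step_None payoff_def g_def flip: c'_def)
    next
      case (Some i)
      define k t t0 where "k = state c i" and "t = elapsed c i" and "t0 = first_tight B D i k"
      have kt: "k \<in> states B i" "t \<ge> 1" using c by (auto simp: valid_def k_def t_def)
      have "Some i \<in> index_actions B D c" using act Some by simp
      then have h: "hval D i > 0" and ready: "t0 \<le> t"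
        by (cases rule: index_actions_Some;
            auto simp: good_arms_def ready_arms_def due_def k_def t_def t0_def)+
      have t0: "1 \<le> t0" using first_tight(1)[OF tight h kt(1)] by (simp add: t0_def)
      \<comment> \<open>The value of \<open>g\<close> after the play if the other arms gain nothing.
        The played arm has elapsed time 1, so its bank is \<open>hval D i\<close> whatever state it
        enters.\<close>
      define G where "G = (\<Sum>j\<in>UNIV. bank B D c j) - bank B D c i + hval D i - closing B i
        - K * real (card (good_arms B D c - {i}))"
      have "G \<le> g c'" if c': "c' \<in> set_pmf (step B c (Some i))" for c'
      proof -
        note st = set_step_play[OF B c c']
        have "first_tight B D i (state c' i) \<ge> 1"
          using first_tight(1)[OF tight h] st(1) by blast
        then have "bank B D c' i = hval D i"
          by (simp add: bank_def st(3) min_def)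
        moreover have "(\<Sum>j\<in>UNIV - {i}. bank B D c j) \<le> (\<Sum>j\<in>UNIV - {i}. bank B D c' j)"
          using st(2,3) by (intro sum_mono bank_mono[OF D]) auto
        moreover have "stale B D c' = good_arms B D c - {i}"
          using st(2,4) unfolding stale_def good_arms_def by force
        ultimately show ?thesis
          by (simp add: G_def g_def st(4) sum.remove[of UNIV i])
      qed
      then have "\<Phi> c + ramp B i k t * drift B D i k + G \<le>
          measure_pmf.expectation (step B c (Some i)) (\<lambda>c. \<Phi> c + g c)"
        unfolding \<Phi>_def k_def t_def drift_eq_flow by (rule expectation_step_play_ge[OF B c])
      moreover have "lam D + g c \<le> payoff B c (Some i) + ramp B i k t * drift B D i k + G"
      proof -
        define \<kappa> where "\<kappa> = switching_cost B (last_played c) i"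
        have pay: "payoff B c (Some i) = reward B i k - \<kappa>"
          by (simp add: payoff_def k_def \<kappa>_def)
        \<comment> \<open>The closing part is already accounted for in \<open>g\<close>; what is
          left to pay is the setup cost now and the closing cost of \<open>i\<close> in the new
          potential.\<close>
        have \<kappa>: "\<kappa> \<le> case_option 0 (closing B) (last_played c) + setup_cost B i"
          using mb(3,4) by (auto simp: \<kappa>_def switching_cost_def intro: add_nonneg_nonneg split: option.split)
        have bank_i: "bank B D c i = hval D i * real t0 +
            (if i \<in> good_arms B D c then lam D * (real t0 - 1) else 0)"
          using ready by (simp add: bank_def t0_def k_def t_def min_def Let_def)
        show ?thesis
          using \<open>Some i \<in> index_actions B D c\<close>
        proof (cases rule: index_actions_Some)
          case 1
          have "t = t0"
            using I 1 ready by (auto simp: index_invariant_def t_def t0_def k_def)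
          moreover have "real t0 * (lam D + hval D i) = reward B i k + ramp B i k t0 * drift B D i k"
            using good_tight good_state(1)[OF 1(1)] by (simp add: t0_def k_def)
          moreover have "stale B D c = good_arms B D c - {i}"
            using 1 by (auto simp: stale_def)
          moreover have "\<kappa> = 0" using 1 by (simp add: \<kappa>_def switching_cost_def)
          ultimately show ?thesis
            using 1 h bank_i pay by (simp add: g_def G_def algebra_simps)
        next
          case 2
          have "real t0 * (lam D + hval D i) = reward B i k + ramp B i k t0 * drift B D i k"
            using good_tight good_state(1)[OF 2(1)] by (simp add: t0_def k_def)
          \<comment> \<open>A stale arm may be played after \<open>t0\<close>, with drift of either
            sign; the error is charged to \<open>K\<close>.\<close>
          moreover have "ramp B i k t0 * drift B D i k - \<bar>drift B D i k\<bar> \<le> ramp B i k t * drift B D i k"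
          proof -
            have "(ramp B i k t0 - ramp B i k t) * drift B D i k \<le>
                \<bar>ramp B i k t0 - ramp B i k t\<bar> * \<bar>drift B D i k\<bar>"
              by (simp flip: abs_mult)
            also have "\<dots> \<le> 1 * \<bar>drift B D i k\<bar>"
              using mb(8,9)[OF kt] mb(8,9)[OF kt(1) t0] by (intro mult_right_mono) auto
            finally have "(ramp B i k t0 - ramp B i k t) * drift B D i k \<le> \<bar>drift B D i k\<bar>" by simp
            then show ?thesis by (simp add: algebra_simps)
          qed
          moreover have "card (good_arms B D c) = Suc (card (good_arms B D c - {i}))"
            using 2(1) by (intro card.remove) simp_all
          then have "K * real (card (stale B D c)) = K + K * real (card (good_arms B D c - {i}))"
            using 2(3) by (simp add: algebra_simps)
          ultimately show ?thesis
            using 2 h bank_i pay \<kappa> K[OF kt(1)] by (simp add: g_def G_def algebra_simps)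
        next
          case 3
          then have ix: "k \<in> index_states B D i" by (simp add: ready_arms_def k_def)
          \<comment> \<open>This is where monotonicity of the ramp pays for the delay of an index
            arm that was ready earlier.\<close>
          have "ramp B i k t0 * drift B D i k \<le> ramp B i k t * drift B D i k"
            using mb(10)[OF kt(1) t0 ready] index_tight(2)[OF B D tight h ix]
            by (intro mult_right_mono)
          moreover have "lam D + real t0 * hval D i =
              reward B i k - closing B i - setup_cost B i + ramp B i k t0 * drift B D i k"
            using index_tight(1)[OF B D tight h ix] by (simp add: t0_def)
          moreover have "stale B D c = {}" using 3 by (simp add: stale_def)
          ultimately show ?thesis
            using 3 h bank_i pay \<kappa> by (simp add: g_def G_def algebra_simps)
        qed
      qed
      ultimately show ?thesis by (simp add: Some)
    qed
  qed
qed

section \<open>Optimal dual solutions\<close>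

text \<open>Once \<open>lam\<close> and \<open>hval\<close> are fixed, the constraints decouple over
  the arms; the potential of a single arm can then be replaced.\<close>

definition arm_feasible :: "('i, 's) bandit \<Rightarrow> 'i \<Rightarrow> real \<Rightarrow> real \<Rightarrow> ('s \<Rightarrow> real) \<Rightarrow> bool" where
  "arm_feasible B i l h p \<longleftrightarrow> (\<forall>k\<in>states B i. \<forall>t\<ge>1.
     reward B i k - closing B i - setup_cost B i + ramp B i k t * flow (states B i) (rate B i) p k
       \<le> l + real t * h \<and>
     reward B i k + ramp B i k t * flow (states B i) (rate B i) p k \<le> real t * (l + h))"

lemma dual_feasible_iff_arms:
  "dual_feasible B D \<longleftrightarrow> (\<forall>i. arm_feasible B i (lam D) (hval D i) (pot D i)) \<and>
     lam D = (\<Sum>i\<in>UNIV. hval D i) \<and> lam D \<ge> 0 \<and> (\<forall>i. hval D i \<ge> 0)"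
  by (simp add: dual_feasible_def arm_feasible_def switch_lhs_def switch_rhs_def stay_lhs_def
      stay_rhs_def drift_eq_flow)

lemma ramp_horizon:
  fixes B :: "('i::finite, 's) bandit"
  assumes "monotone_bandit B"
  shows "\<exists>M\<ge>1. \<forall>i. \<forall>k\<in>states B i. \<forall>t\<ge>M. ramp B i k t = ramp B i k M"
proof -
  define M where "M = Suc (\<Sum>i\<in>UNIV. \<Sum>k\<in>states B i. Max (breaks B i k))"
  have "Max (breaks B i k) \<le> M" if k: "k \<in> states B i" for i k
  proof -
    have "Max (breaks B i k) \<le> (\<Sum>k\<in>states B i. Max (breaks B i k))"
      using k monotone_banditD(1)[OF assms] by (intro member_le_sum) auto
    also have "\<dots> \<le> (\<Sum>i\<in>UNIV. \<Sum>k\<in>states B i. Max (breaks B i k))"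
      by (rule member_le_sum[of i UNIV "\<lambda>i. \<Sum>k\<in>states B i. Max (breaks B i k)"]) auto
    finally show ?thesis by (simp add: M_def)
  qed
  moreover have "ramp B i k t = ramp B i k (Max (breaks B i k))"
    if "k \<in> states B i" "t \<ge> Max (breaks B i k)" for i k t
  proof -
    have "piecewise_linear (breaks B i k) (ramp B i k)"
      using assms that(1) unfolding monotone_bandit_def by blast
    then show ?thesis using that(2) unfolding piecewise_linear_def by blast
  qed
  ultimately have "\<forall>i. \<forall>k\<in>states B i. \<forall>t\<ge>M. ramp B i k t = ramp B i k M"
    by (metis order_trans)
  moreover have "M \<ge> 1" by (simp add: M_def)
  ultimately show ?thesis by blast
qed

text \<open>Beyond the horizon \<open>M\<close> the right-hand sides of the dual constraints are
  constant while the left-hand sides do not decrease, so finitely many constraints remain. This is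
  what makes uniform small perturbations possible.\<close>

lemma arm_feasible_finite:
  assumes M: "M \<ge> 1" "\<And>k t. k \<in> states B i \<Longrightarrow> t \<ge> M \<Longrightarrow> ramp B i k t = ramp B i k M"
    and l: "l \<ge> 0" "h \<ge> 0"
    and le: "\<And>k t. k \<in> states B i \<Longrightarrow> t \<in> {1..M} \<Longrightarrow>
      reward B i k - closing B i - setup_cost B i + ramp B i k t * flow (states B i) (rate B i) p k
        \<le> l + real t * h \<and>
      reward B i k + ramp B i k t * flow (states B i) (rate B i) p k \<le> real t * (l + h)"
  shows "arm_feasible B i l h p"
  unfolding arm_feasible_def
proof (intro ballI allI impI)
  fix k and t :: nat assume k: "k \<in> states B i" and t: "t \<ge> 1"
  show "reward B i k - closing B i - setup_cost B i + ramp B i k t * flow (states B i) (rate B i) p k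
       \<le> l + real t * h \<and>
     reward B i k + ramp B i k t * flow (states B i) (rate B i) p k \<le> real t * (l + h)"
  proof (cases "t \<le> M")
    case True
    then show ?thesis using le[OF k, of t] t by simp
  next
    case False
    then have "real M * h \<le> real t * h" "real M * (l + h) \<le> real t * (l + h)"
      using l by (auto intro!: mult_right_mono)
    then show ?thesis using le[OF k, of M] M(1) M(2)[OF k, of t] False by auto
  qed
qed

section \<open>Perturbation of an optimal dual solution with a never tight state\<close>

lemma eventually_small_perturbation:
  fixes a b c :: real
  assumes "a < b"
  shows "\<forall>\<^sub>F e in at_right 0. a + e * c < b"
proof (rule order_tendstoD(2)[OF _ assms])
  have "((\<lambda>e. a + e * c) \<longlongrightarrow> a + 0 * c) (at_right 0)"
    by (intro tendsto_intros)
  then show "((\<lambda>e. a + e * c) \<longlongrightarrow> a) (at_right 0)" by simp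
qed

text \<open>Were there no such state, adding a small multiple of a potential that descends towards the
  never tight state would make all constraints of arm \<open>i\<close> strict; then \<open>hval D i\<close> could be lowered
  in favour of the other arms, and with it \<open>lam D\<close>.\<close>

lemma never_tight_absorbing:
  fixes B :: "('i::finite, 's) bandit"
  assumes B: "monotone_bandit B" and D: "dual_optimal B D"
    and h: "hval D i > 0" and never: "never_tight B D i"
  shows "\<exists>k\<in>states B i. ramp B i k 1 = 0 \<and> reward B i k = lam D + hval D i"
proof (rule ccontr)
  assume no: "\<not> ?thesis"
  note mb = monotone_banditD[OF B]
  let ?S = "states B i" and ?q = "rate B i" and ?c = "closing B i + setup_cost B i"
  have feas: "dual_feasible B D" using D by (simp add: dual_optimal_def)
  note dual = dual_feasibleD[OF feas]
  obtain z where z: "z \<in> ?S" "\<And>t. t \<ge> 1 \<Longrightarrow> \<not> tight B D i z t"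
    using never by (auto simp: never_tight_def)
  obtain u where u: "\<And>k. k \<in> ?S - {z} \<Longrightarrow> flow ?S ?q u k \<le> - 1"
    using descent_potential[OF mb(1) mb(6) mb(11)[OF z(1)], where w = "\<lambda>_. 1"] by blast
  obtain M where M: "M \<ge> 1" "\<And>i k t. k \<in> states B i \<Longrightarrow> t \<ge> M \<Longrightarrow> ramp B i k t = ramp B i k M"
    using ramp_horizon[OF B] by blast
  let ?d = "\<lambda>e k. drift B D i k + e * flow ?S ?q u k"
  \<comment> \<open>Where the ramp vanishes no change of potential helps. There the ramp vanishes at
    time 1 too, by monotonicity, and strictness comes from the assumption \<open>no\<close>.\<close>
  have strict0: "reward B i k - ?c < lam D + real t * hval D i \<and> reward B i k < real t * (lam D + hval D i)"
    if k: "k \<in> ?S" and t: "t \<ge> 1" and f: "ramp B i k t = 0" for k t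
  proof -
    have f1: "ramp B i k 1 = 0"
      using mb(8)[OF k, of 1] mb(10)[OF k _ t] f by simp
    then have "reward B i k \<noteq> lam D + hval D i" using no k by blast
    then have "reward B i k < lam D + hval D i"
      using dual(2)[OF k, of 1] f1 by simp
    moreover have "1 * hval D i \<le> real t * hval D i" "1 * (lam D + hval D i) \<le> real t * (lam D + hval D i)"
      using t h dual(4) by (intro mult_right_mono; simp)+
    ultimately show ?thesis using mb(3,4)[of i] by auto
  qed
  have "\<forall>\<^sub>F e in at_right 0.
      reward B i k - ?c + ramp B i k t * ?d e k < lam D + real t * hval D i \<and>
      reward B i k + ramp B i k t * ?d e k < real t * (lam D + hval D i)"
    if k: "k \<in> ?S" and t: "t \<in> {1..M}" for k t
  proof -
    have t1: "t \<ge> 1" using t by simp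
    \<comment> \<open>At \<open>z\<close> the constraints have slack, which absorbs a small rise of
      the flow; at other states with positive ramp the added potential strictly lowers the drift
      term.\<close>
    consider "ramp B i k t = 0" | "k = z" | "k \<noteq> z" "ramp B i k t > 0"
      using mb(8)[OF k t1] by fastforce
    then show ?thesis
    proof cases
      case 1
      then show ?thesis using strict0[OF k t1] by simp
    next
      case 2
      have "reward B i k - ?c + ramp B i k t * drift B D i k < lam D + real t * hval D i"
        "reward B i k + ramp B i k t * drift B D i k < real t * (lam D + hval D i)"
        using z(2)[OF t1] dual(1,2)[OF k t1] 2
        by (auto simp: tight_def switch_lhs_def switch_rhs_def stay_lhs_def stay_rhs_def)
      from this[THEN eventually_small_perturbation, of "ramp B i k t * flow ?S ?q u k"]
      show ?thesis by eventually_elim (simp add: algebra_simps)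
    next
      case 3
      show ?thesis
        using eventually_at_right_less[of "0::real"]
      proof eventually_elim
        case (elim e)
        have "e * flow ?S ?q u k \<le> e * - 1"
          using elim u[of k] 3 k by (intro mult_left_mono) auto
        then have "ramp B i k t * ?d e k < ramp B i k t * drift B D i k"
          using 3(2) elim by (intro mult_strict_left_mono) auto
        then show ?case using dual(1,2)[OF k t1] by linarith
      qed
    qed
  qed
  then have "\<forall>\<^sub>F e in at_right 0. \<forall>k\<in>?S. \<forall>t\<in>{1..M}.
      reward B i k - ?c + ramp B i k t * ?d e k < lam D + real t * hval D i \<and>
      reward B i k + ramp B i k t * ?d e k < real t * (lam D + hval D i)"
    using mb(1) by (intro eventually_ball_finite ballI) auto
  then have "\<exists>e. \<forall>k\<in>?S. \<forall>t\<in>{1..M}.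
      reward B i k - ?c + ramp B i k t * ?d e k < lam D + real t * hval D i \<and>
      reward B i k + ramp B i k t * ?d e k < real t * (lam D + hval D i)"
    by (rule eventually_happens'[rotated]) simp
  then obtain e where e: "\<And>k t. k \<in> ?S \<Longrightarrow> t \<in> {1..M} \<Longrightarrow>
      reward B i k - ?c + ramp B i k t * ?d e k < lam D + real t * hval D i"
      "\<And>k t. k \<in> ?S \<Longrightarrow> t \<in> {1..M} \<Longrightarrow>
      reward B i k + ramp B i k t * ?d e k < real t * (lam D + hval D i)"
    by blast
  \<comment> \<open>Arm \<open>i\<close> gives up \<open>\<delta> * ?n\<close> and each other arm
    gains \<open>\<delta>\<close>, so the sum of \<open>hval\<close> drops by
    \<open>\<delta>\<close>, the same as \<open>lam\<close>. For the other arms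
    \<open>lam + hval\<close> is unchanged and \<open>lam + t * hval\<close> does not drop for
    \<open>t \<ge> 1\<close>.\<close>
  let ?n = "real CARD('i)"
  have "\<forall>\<^sub>F \<delta> in at_right 0. \<forall>k\<in>?S. \<forall>t\<in>{1..M}.
      reward B i k - ?c + ramp B i k t * ?d e k + \<delta> * (1 + real t * ?n) < lam D + real t * hval D i \<and>
      reward B i k + ramp B i k t * ?d e k + \<delta> * (real t * (1 + ?n)) < real t * (lam D + hval D i)"
    using mb(1) e by (intro eventually_ball_finite ballI eventually_conj eventually_small_perturbation) auto
  moreover have "\<forall>\<^sub>F \<delta> in at_right 0. 0 + \<delta> * ?n < hval D i"
    using h by (rule eventually_small_perturbation)
  moreover have "hval D i \<le> lam D"
    unfolding dual(3) using dual(5) by (intro member_le_sum) auto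
  then have "\<forall>\<^sub>F \<delta> in at_right 0. 0 + \<delta> * 1 < lam D"
    using h by (intro eventually_small_perturbation) simp
  moreover have "\<forall>\<^sub>F \<delta> in at_right (0::real). 0 < \<delta>"
    by (rule eventually_at_right_less)
  ultimately have "\<forall>\<^sub>F \<delta> in at_right 0. (\<forall>k\<in>?S. \<forall>t\<in>{1..M}.
      reward B i k - ?c + ramp B i k t * ?d e k + \<delta> * (1 + real t * ?n) < lam D + real t * hval D i \<and>
      reward B i k + ramp B i k t * ?d e k + \<delta> * (real t * (1 + ?n)) < real t * (lam D + hval D i)) \<and>
      0 + \<delta> * ?n < hval D i \<and> 0 + \<delta> * 1 < lam D \<and> 0 < \<delta>"
    by (intro eventually_conj)
  then have "\<exists>\<delta>. (\<forall>k\<in>?S. \<forall>t\<in>{1..M}.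
      reward B i k - ?c + ramp B i k t * ?d e k + \<delta> * (1 + real t * ?n) < lam D + real t * hval D i \<and>
      reward B i k + ramp B i k t * ?d e k + \<delta> * (real t * (1 + ?n)) < real t * (lam D + hval D i)) \<and>
      0 + \<delta> * ?n < hval D i \<and> 0 + \<delta> * 1 < lam D \<and> 0 < \<delta>"
    by (rule eventually_happens'[rotated]) simp
  then obtain \<delta> where \<delta>: "\<And>k t. k \<in> ?S \<Longrightarrow> t \<in> {1..M} \<Longrightarrow>
      reward B i k - ?c + ramp B i k t * ?d e k + \<delta> * (1 + real t * ?n) < lam D + real t * hval D i \<and>
      reward B i k + ramp B i k t * ?d e k + \<delta> * (real t * (1 + ?n)) < real t * (lam D + hval D i)"
      "\<delta> * ?n < hval D i" "\<delta> < lam D" "0 < \<delta>"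
    unfolding add_0_left mult_1_right by blast
  define D' where "D' = \<lparr>lam = lam D - \<delta>,
      hval = (\<lambda>j. if j = i then hval D i - \<delta> * ?n else hval D j + \<delta>),
      pot = (pot D)(i := \<lambda>x. pot D i x + e * u x)\<rparr>"
  have sum': "(\<Sum>j\<in>UNIV. hval D' j) = lam D - \<delta>"
  proof -
    have "(\<Sum>j\<in>UNIV. hval D' j) = (\<Sum>j\<in>UNIV. hval D j + \<delta> - (if j = i then \<delta> * (1 + ?n) else 0))"
      by (intro sum.cong) (auto simp: D'_def algebra_simps)
    also have "\<dots> = lam D - \<delta>"
      by (simp add: sum.distrib sum_subtractf dual(3) algebra_simps)
    finally show ?thesis .
  qed
  have "arm_feasible B j (lam D') (hval D' j) (pot D' j)" for j
  proof (cases "j = i")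
    case True
    have "arm_feasible B i (lam D') (hval D' i) (pot D' i)"
    proof (rule arm_feasible_finite[OF M(1) M(2)])
      fix k t assume kt: "k \<in> ?S" "t \<in> {1..M}"
      have "flow ?S ?q (pot D' i) k = ?d e k"
        by (simp add: D'_def flow_add flow_scale drift_eq_flow)
      then show "reward B i k - closing B i - setup_cost B i + ramp B i k t * flow ?S ?q (pot D' i) k
          \<le> lam D' + real t * hval D' i \<and>
        reward B i k + ramp B i k t * flow ?S ?q (pot D' i) k \<le> real t * (lam D' + hval D' i)"
        using \<delta>(1)[OF kt] by (simp add: D'_def algebra_simps)
    qed (use \<delta> in \<open>auto simp: D'_def\<close>)
    then show ?thesis using True by simp
  next
    case False
    have D'_j: "lam D' = lam D - \<delta>" "hval D' j = hval D j + \<delta>" and pot: "pot D' j = pot D j"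
      using False by (simp_all add: D'_def)
    have stay: "lam D' + hval D' j = lam D + hval D j" by (simp add: D'_j)
    have switch: "lam D + real t * hval D j \<le> lam D' + real t * hval D' j" if "t \<ge> 1" for t
    proof -
      have "1 * \<delta> \<le> real t * \<delta>" using that \<delta>(4) by (intro mult_right_mono) auto
      then show ?thesis by (simp add: D'_j distrib_left)
    qed
    show ?thesis
      unfolding arm_feasible_def
    proof (intro ballI allI impI)
      fix k and t :: nat assume k: "k \<in> states B j" and t: "t \<ge> 1"
      show "reward B j k - closing B j - setup_cost B j +
          ramp B j k t * flow (states B j) (rate B j) (pot D' j) k \<le> lam D' + real t * hval D' j \<and>
        reward B j k + ramp B j k t * flow (states B j) (rate B j) (pot D' j) k
          \<le> real t * (lam D' + hval D' j)"
        using dual(1,2)[OF k t] switch[OF t] unfolding pot stay drift_eq_flow by simp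
    qed
  qed
  moreover have lam': "lam D' = lam D - \<delta>" by (simp add: D'_def)
  moreover have "0 \<le> hval D' j" for j
    using \<delta> dual(5)[of j] by (simp add: D'_def)
  ultimately have "dual_feasible B D'"
    using sum' \<delta>(3) unfolding dual_feasible_iff_arms by simp
  then have "dual_objective D \<le> dual_objective D'"
    using D by (simp add: dual_optimal_def)
  then show False
    using sum' lam' dual(3) \<delta>(4) unfolding dual_objective_def by linarith
qed

lemma play_absorbing_state:
  fixes B :: "('i::finite, 's) bandit"
  assumes B: "monotone_bandit B" and k: "k \<in> states B i" and f: "ramp B i k 1 = 0"
  shows "\<exists>c0\<in>starts B. lower_value B (\<lambda>past c. return_pmf (Some i)) c0 \<ge> ereal (reward B i k)"
proof -
  note mb = monotone_banditD[OF B]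
  \<comment> \<open>Elapsed time 1 is essential: the ramp of \<open>k\<close> is known to vanish
    only there, and repeated play keeps the elapsed time at 1.\<close>
  define c0 where "c0 = \<lparr>state = (\<lambda>j. if j = i then k else SOME x. x \<in> states B j),
    elapsed = (\<lambda>_. 1), last_played = None\<rparr>"
  have "(SOME x. x \<in> states B j) \<in> states B j" for j
    using mb(2)[of j] by (simp add: some_in_eq)
  then have c0: "c0 \<in> starts B" using k by (simp add: c0_def starts_def)
  define I where "I c \<longleftrightarrow> valid B c \<and> state c i = k \<and> elapsed c i = 1 \<and> last_played c \<in> {None, Some i}"
    for c :: "('i, 's) config"
  have stay: "set_pmf (move B i k 1) \<subseteq> {k}"
    using f by (auto simp: set_pmf_iff pmf_move[OF B k] split: if_splits)
  have "lower_value B (\<lambda>past c. return_pmf (Some i)) c0 \<ge> ereal (reward B i k)"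
  proof (rule lower_value_ge[where I = I and \<Psi> = "\<lambda>_. 0" and K = 0])
    show "monotone_bandit B" by fact
    show "I c0" using c0 by (simp add: I_def valid_def starts_def c0_def)
    show "valid B c" if "I c" for c using that by (simp add: I_def)
    show "I c'" if "I c" "a \<in> set_pmf (return_pmf (Some i))" "c' \<in> set_pmf (step B c a)" for c a c'
    proof -
      have "valid B c'" using valid_step[OF B _ that(3)] that(1) by (simp add: I_def)
      then show ?thesis using that stay by (auto simp: I_def step_def)
    qed
    show "reward B i k + 0 \<le> payoff B c a + measure_pmf.expectation (step B c a) (\<lambda>_. 0)"
      if "I c" "a \<in> set_pmf (return_pmf (Some i))" for c a
      using that by (auto simp: I_def payoff_def switching_cost_def)
  qed simp
  then show ?thesis using c0 by blast
qed

section \<open>Existence of an optimal dual solution by compactness\<close>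

lemma bounded_coordinates_subseq:
  fixes x :: "nat \<Rightarrow> 'k \<Rightarrow> real"
  assumes "finite A" "\<And>k n. k \<in> A \<Longrightarrow> \<bar>x n k\<bar> \<le> C k"
  shows "\<exists>\<phi>. strict_mono \<phi> \<and> (\<forall>k\<in>A. convergent (\<lambda>n. x (\<phi> n) k))"
  using assms
proof (induction A rule: finite_induct)
  case empty
  then show ?case by (intro exI[of _ id]) (simp add: strict_mono_id)
next
  case (insert k A)
  then obtain \<phi> where \<phi>: "strict_mono \<phi>" "\<And>k. k \<in> A \<Longrightarrow> convergent (\<lambda>n. x (\<phi> n) k)" by auto
  have "bounded (range (\<lambda>n. x (\<phi> n) k))"
    using insert.prems by (intro boundedI[of _ "C k"]) auto
  then obtain l r where r: "strict_mono r" "((\<lambda>n. x (\<phi> n) k) \<circ> r) \<longlonglongrightarrow> l"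
    using bounded_imp_convergent_subsequence by blast
  have "convergent (\<lambda>n. x ((\<phi> \<circ> r) n) j)" if "j \<in> insert k A" for j
  proof (cases "j = k")
    case True
    then show ?thesis using r(2) by (auto simp: convergent_def o_def)
  next
    case False
    then show ?thesis
      using convergent_subseq_convergent[OF \<phi>(2) r(1), of j] that by (simp add: o_def)
  qed
  moreover have "strict_mono (\<phi> \<circ> r)" using \<phi>(1) r(1) by (rule strict_mono_o)
  ultimately show ?case by blast
qed

text \<open>The potential need not be bounded by itself: a state with vanishing ramp does not constrain
  it.  But then a fixed potential descending steeply towards that state is feasible for all
  relevant \<open>(l, h)\<close>.\<close>

lemma bounded_arm_potential:
  fixes B :: "('i::finite, 's) bandit"
  assumes B: "monotone_bandit B"
  shows "\<exists>C. \<forall>l h p. 0 \<le> l \<and> l \<le> \<Lambda> \<and> 0 \<le> h \<and> h \<le> \<Lambda> \<and> arm_feasible B i l h p \<longrightarrow>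
    (\<exists>p'. arm_feasible B i l h p' \<and> (\<forall>k\<in>states B i. \<bar>p' k\<bar> \<le> C))"
proof -
  note mb = monotone_banditD[OF B]
  let ?S = "states B i" and ?q = "rate B i"
  obtain M where M: "M \<ge> 1" "\<And>i k t. k \<in> states B i \<Longrightarrow> t \<ge> M \<Longrightarrow> ramp B i k t = ramp B i k M"
    using ramp_horizon[OF B] by blast
  show ?thesis
  proof (cases "\<exists>z\<in>?S. \<forall>t\<ge>1. ramp B i z t = 0")
    case True
    then obtain z where z: "z \<in> ?S" "\<And>t. t \<ge> 1 \<Longrightarrow> ramp B i z t = 0" by blast
    \<comment> \<open>At least \<open>reward / ramp\<close> for each \<open>t\<close> of positive
      ramp, so a flow below \<open>- w\<close> cancels the reward; terms with zero ramp are 0 by the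
      convention for division.\<close>
    define w where "w k = (\<Sum>t\<in>{1..M}. reward B i k / ramp B i k t)" for k
    obtain u where u: "\<And>k. k \<in> ?S - {z} \<Longrightarrow> flow ?S ?q u k \<le> - w k"
      using descent_potential[OF mb(1) mb(6) mb(11)[OF z(1)], where w = w] by blast
    have "arm_feasible B i l h u" if l: "0 \<le> l" "0 \<le> h" and p: "arm_feasible B i l h p" for l h p
    proof (rule arm_feasible_finite[OF M(1) M(2) l])
      fix k t assume k: "k \<in> ?S" and t: "t \<in> {1..M}"
      have t1: "t \<ge> 1" using t by simp
      \<comment> \<open>With zero ramp the constraint does not see the potential and is inherited
        from \<open>p\<close>; otherwise reward and drift term together are nonpositive.\<close>
      have "ramp B i k t = 0 \<or> reward B i k + ramp B i k t * flow ?S ?q u k \<le> 0"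
      proof (cases "ramp B i k t = 0")
        case False
        then have f: "ramp B i k t > 0" and kz: "k \<noteq> z" using mb(8)[OF k t1] z(2)[OF t1] by auto
        have "reward B i k / ramp B i k t \<le> w k"
          unfolding w_def using t mb(5,8)[OF k]
          by (intro member_le_sum[of t "{1..M}" "\<lambda>t. reward B i k / ramp B i k t"]) auto
        then have "reward B i k / ramp B i k t \<le> - flow ?S ?q u k" using u[of k] k kz by simp
        then show ?thesis using f by (simp add: field_simps)
      qed simp
      moreover have nonneg: "0 \<le> real t * h" "0 \<le> real t * (l + h)" using l by auto
      moreover have pk: "reward B i k - closing B i - setup_cost B i + ramp B i k t * flow ?S ?q p k
          \<le> l + real t * h" "reward B i k + ramp B i k t * flow ?S ?q p k \<le> real t * (l + h)"
        using p k t1 unfolding arm_feasible_def by blast+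
      ultimately show "reward B i k - closing B i - setup_cost B i + ramp B i k t * flow ?S ?q u k
          \<le> l + real t * h \<and> reward B i k + ramp B i k t * flow ?S ?q u k \<le> real t * (l + h)"
        using pk nonneg l mb(3,4)[of i]
        by (elim disjE; intro conjI; (simp; fail | linarith))
    qed
    moreover have "\<bar>u k\<bar> \<le> (\<Sum>k\<in>?S. \<bar>u k\<bar>)" if "k \<in> ?S" for k
      using that mb(1) by (intro member_le_sum) auto
    ultimately show ?thesis by blast
  next
    case False
    have fM: "ramp B i k M > 0" if k: "k \<in> ?S" for k
    proof -
      obtain t where t: "t \<ge> 1" "ramp B i k t \<noteq> 0" using False k by blast
      have "0 < ramp B i k t" using mb(8)[OF k t(1)] t(2) by simp
      also have "\<dots> \<le> ramp B i k (max t M)" using mb(10)[OF k t(1)] by simp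
      also have "\<dots> = ramp B i k M" using M(2)[OF k, of "max t M"] by simp
      finally show ?thesis .
    qed
    \<comment> \<open>The staying constraint at the horizon \<open>M\<close>, where every ramp is
      now positive, bounds the flow of any feasible potential; \<open>2 * \<Lambda>\<close> bounds
      \<open>l + h\<close>.\<close>
    define U where "U = (\<Sum>k\<in>?S. \<bar>real M * (2 * \<Lambda>) / ramp B i k M\<bar>)"
    have "\<exists>C. \<forall>v. (\<forall>k\<in>?S. flow ?S ?q v k \<le> U) \<and> (\<forall>k\<in>?S. v k \<ge> 0) \<and> (\<exists>k\<in>?S. v k = 0) \<longrightarrow>
        (\<forall>k\<in>?S. v k \<le> C)"
      using mb(1,6,7,11) by (rule potential_bound)
    then obtain C where C: "\<forall>v. (\<forall>k\<in>?S. flow ?S ?q v k \<le> U) \<and> (\<forall>k\<in>?S. v k \<ge> 0) \<and>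
        (\<exists>k\<in>?S. v k = 0) \<longrightarrow> (\<forall>k\<in>?S. v k \<le> C)"
      by (rule exE)
    have "\<exists>p'. arm_feasible B i l h p' \<and> (\<forall>k\<in>?S. \<bar>p' k\<bar> \<le> C)"
      if l: "0 \<le> l" "l \<le> \<Lambda>" "0 \<le> h" "h \<le> \<Lambda>" and p: "arm_feasible B i l h p" for l h p
    proof -
      have flow_le: "flow ?S ?q p k \<le> U" if k: "k \<in> ?S" for k
      proof -
        have "reward B i k + ramp B i k M * flow ?S ?q p k \<le> real M * (l + h)"
          using p k M(1) unfolding arm_feasible_def by blast
        then have "ramp B i k M * flow ?S ?q p k \<le> real M * (l + h)"
          using mb(5)[OF k] by linarith
        also have "\<dots> \<le> real M * (2 * \<Lambda>)" using l by (intro mult_left_mono) auto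
        finally have "flow ?S ?q p k \<le> \<bar>real M * (2 * \<Lambda>) / ramp B i k M\<bar>"
          using fM[OF k] by (simp add: field_simps)
        also have "\<dots> \<le> U"
          unfolding U_def using k mb(1)
          by (intro member_le_sum[of k ?S "\<lambda>k. \<bar>real M * (2 * \<Lambda>) / ramp B i k M\<bar>"]) auto
        finally show ?thesis .
      qed
      \<comment> \<open>Constraints see only differences of the potential, so its minimum may be
        moved to 0.\<close>
      let ?v = "\<lambda>x. p x - Min (p ` ?S)"
      have "Min (p ` ?S) \<in> p ` ?S" using mb(1,2) by (intro Min_in) auto
      then have "\<exists>k\<in>?S. ?v k = 0" by auto
      moreover have nonneg: "\<forall>k\<in>?S. ?v k \<ge> 0" using mb(1) by auto
      moreover have "\<forall>k\<in>?S. flow ?S ?q ?v k \<le> U" using flow_le by (simp add: flow_shift)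
      ultimately have "\<forall>k\<in>?S. ?v k \<le> C" using C[rule_format, of ?v] by blast
      moreover have "arm_feasible B i l h ?v" using p by (simp add: arm_feasible_def flow_shift)
      ultimately show ?thesis using nonneg by (intro exI[of _ ?v]) auto
    qed
    then show ?thesis by blast
  qed
qed

text \<open>For the zero potential, large enough \<open>hval\<close> dominates all rewards;
  \<open>lam\<close> is then dictated by the balance condition.\<close>

lemma dual_feasible_exists:
  fixes B :: "('i::finite, 's) bandit"
  assumes B: "monotone_bandit B"
  shows "\<exists>D. dual_feasible B D"
proof -
  note mb = monotone_banditD[OF B]
  define H where "H = (\<Sum>i\<in>UNIV. \<Sum>k\<in>states B i. reward B i k)"
  have H: "reward B i k \<le> H" if "k \<in> states B i" for i k
  proof -
    have "reward B i k \<le> (\<Sum>k\<in>states B i. reward B i k)"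
      using that mb by (intro member_le_sum) auto
    also have "\<dots> \<le> H"
      unfolding H_def using mb
      by (intro member_le_sum[of i UNIV "\<lambda>i. \<Sum>k\<in>states B i. reward B i k"]) (auto intro: sum_nonneg)
    finally show ?thesis .
  qed
  have H0: "H \<ge> 0" unfolding H_def using mb by (auto intro!: sum_nonneg)
  let ?L = "real CARD('i) * H"
  have "arm_feasible B i ?L H (\<lambda>_. 0)" for i
    unfolding arm_feasible_def
  proof (intro ballI allI impI)
    fix k and t :: nat assume k: "k \<in> states B i" and t: "t \<ge> 1"
    have "1 * H \<le> real t * H" "1 * (?L + H) \<le> real t * (?L + H)" "0 \<le> ?L"
      using t H0 by (intro mult_right_mono; simp)+ (use H0 in simp)
    then show "reward B i k - closing B i - setup_cost B i +
        ramp B i k t * flow (states B i) (rate B i) (\<lambda>_. 0) k \<le> ?L + real t * H \<and>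
      reward B i k + ramp B i k t * flow (states B i) (rate B i) (\<lambda>_. 0) k \<le> real t * (?L + H)"
      using H[OF k] mb(3,4)[of i] by (simp add: flow_def)
  qed
  then have "dual_feasible B \<lparr>lam = ?L, hval = \<lambda>_. H, pot = \<lambda>_ _. 0\<rparr>"
    using H0 by (simp add: dual_feasible_iff_arms)
  then show ?thesis by blast
qed

text \<open>By balance the objective is \<open>2 * lam\<close>, so it is enough to minimize
  \<open>lam\<close>. Along a minimizing sequence each \<open>hval\<close> is at most
  \<open>lam\<close>, potentials are replaced by bounded ones, and each constraint passes to the
  limit of a subsequence.\<close>

lemma dual_optimal_exists:
  fixes B :: "('i::finite, 's) bandit"
  assumes B: "monotone_bandit B"
  shows "\<exists>D. dual_optimal B D"
proof -
  note mb = monotone_banditD[OF B]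
  define A where "A = {lam D |D. dual_feasible B D}"
  have A: "A \<noteq> {}" "bdd_below A"
    using dual_feasible_exists[OF B] dual_feasibleD(4) by (auto simp: A_def intro!: bdd_belowI[of _ 0])
  define L where "L = Inf A"
  have L_le: "L \<le> lam D" if "dual_feasible B D" for D
    unfolding L_def using that A by (intro cInf_lower) (auto simp: A_def)
  have "\<exists>D. dual_feasible B D \<and> lam D < L + 1 / real (Suc n)" for n
  proof -
    have "Inf A < L + 1 / real (Suc n)" by (simp add: L_def)
    then obtain a where "a \<in> A" "a < L + 1 / real (Suc n)" using cInf_lessD[OF A(1)] by blast
    then show ?thesis by (auto simp: A_def)
  qed
  then obtain Dn where Dn: "\<And>n. dual_feasible B (Dn n)" "\<And>n. lam (Dn n) < L + 1 / real (Suc n)"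
    by metis
  have lam_lim: "(\<lambda>n. lam (Dn n)) \<longlonglongrightarrow> L"
  proof (rule tendsto_sandwich)
    show "\<forall>\<^sub>F n in sequentially. L \<le> lam (Dn n)" using L_le Dn(1) by simp
    show "\<forall>\<^sub>F n in sequentially. lam (Dn n) \<le> L + 1 / real (Suc n)"
      using Dn(2) by (simp add: less_imp_le)
    have "(\<lambda>n. L + 1 / real (Suc n)) \<longlonglongrightarrow> L + 0"
      using LIMSEQ_inverse_real_of_nat by (intro tendsto_intros) (simp add: inverse_eq_divide)
    then show "(\<lambda>n. L + 1 / real (Suc n)) \<longlonglongrightarrow> L" by simp
  qed simp
  have lam_le: "lam (Dn n) \<le> L + 1" for n
  proof -
    have "1 / real (Suc n) \<le> 1" by simp
    then show ?thesis using Dn(2)[of n] by linarith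
  qed
  have h: "0 \<le> hval (Dn n) i" "hval (Dn n) i \<le> L + 1" for n i
  proof -
    show h0: "0 \<le> hval (Dn n) i" for i using dual_feasibleD(5)[OF Dn(1)] .
    have "hval (Dn n) i \<le> lam (Dn n)"
      unfolding dual_feasibleD(3)[OF Dn(1)] using h0 by (intro member_le_sum) auto
    then show "hval (Dn n) i \<le> L + 1" using lam_le[of n] by simp
  qed
  have "\<forall>i. \<exists>C. \<forall>l h p. 0 \<le> l \<and> l \<le> L + 1 \<and> 0 \<le> h \<and> h \<le> L + 1 \<and> arm_feasible B i l h p \<longrightarrow>
    (\<exists>p'. arm_feasible B i l h p' \<and> (\<forall>k\<in>states B i. \<bar>p' k\<bar> \<le> C))"
    using bounded_arm_potential[OF B] by blast
  then obtain C where C: "\<And>i l h p. 0 \<le> l \<Longrightarrow> l \<le> L + 1 \<Longrightarrow> 0 \<le> h \<Longrightarrow> h \<le> L + 1 \<Longrightarrow>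
      arm_feasible B i l h p \<Longrightarrow> \<exists>p'. arm_feasible B i l h p' \<and> (\<forall>k\<in>states B i. \<bar>p' k\<bar> \<le> C i)"
    by metis
  have "\<exists>p'. arm_feasible B i (lam (Dn n)) (hval (Dn n) i) p' \<and> (\<forall>k\<in>states B i. \<bar>p' k\<bar> \<le> C i)" for n i
    using Dn(1)[of n] lam_le[of n] h[of n i] by (intro C) (auto simp: dual_feasible_iff_arms)
  then have "\<exists>P. \<forall>n i. arm_feasible B i (lam (Dn n)) (hval (Dn n) i) (P n i) \<and>
      (\<forall>k\<in>states B i. \<bar>P n i k\<bar> \<le> C i)"
    by (intro choice allI) auto
  then obtain P where P: "\<And>n i. arm_feasible B i (lam (Dn n)) (hval (Dn n) i) (P n i)"
      "\<And>n i k. k \<in> states B i \<Longrightarrow> \<bar>P n i k\<bar> \<le> C i"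
    by blast
  \<comment> \<open>One family of coordinates for a single subsequence. Only potentials at actual
    states are included, which keeps it finite; entries of \<open>pot\<close> elsewhere never enter
    a constraint.\<close>
  define x where "x n = case_sum (\<lambda>i. hval (Dn n) i) (\<lambda>(i, k). P n i k)" for n
  have "\<exists>\<phi>. strict_mono \<phi> \<and> (\<forall>k\<in>Inl ` UNIV \<union> Inr ` (SIGMA i:UNIV. states B i). convergent (\<lambda>n. x (\<phi> n) k))"
    using mb(1) P(2) h
    by (intro bounded_coordinates_subseq[where C = "case_sum (\<lambda>_. L + 1) (\<lambda>(i, k). C i)"])
       (auto simp: x_def)
  then obtain \<phi> where \<phi>: "strict_mono \<phi>"
      "\<And>i. convergent (\<lambda>n. hval (Dn (\<phi> n)) i)"
      "\<And>i k. k \<in> states B i \<Longrightarrow> convergent (\<lambda>n. P (\<phi> n) i k)"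
    by (auto simp: x_def ball_Un)
  define D where "D = \<lparr>lam = L, hval = \<lambda>i. lim (\<lambda>n. hval (Dn (\<phi> n)) i),
    pot = \<lambda>i k. lim (\<lambda>n. P (\<phi> n) i k)\<rparr>"
  have lim_lam: "(\<lambda>n. lam (Dn (\<phi> n))) \<longlonglongrightarrow> lam D"
    using LIMSEQ_subseq_LIMSEQ[OF lam_lim \<phi>(1)] by (simp add: D_def o_def)
  have lim_h: "(\<lambda>n. hval (Dn (\<phi> n)) i) \<longlonglongrightarrow> hval D i" for i
    using \<phi>(2) by (simp add: D_def convergent_LIMSEQ_iff)
  have lim_p: "(\<lambda>n. P (\<phi> n) i k) \<longlonglongrightarrow> pot D i k" if "k \<in> states B i" for i k
    using \<phi>(3) that by (simp add: D_def convergent_LIMSEQ_iff)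
  have lim_flow: "(\<lambda>n. flow (states B i) (rate B i) (P (\<phi> n) i) k) \<longlonglongrightarrow>
      flow (states B i) (rate B i) (pot D i) k" if "k \<in> states B i" for i k
    unfolding flow_def using that by (intro tendsto_intros lim_p) auto
  have "arm_feasible B i (lam D) (hval D i) (pot D i)" for i
    unfolding arm_feasible_def
  proof (intro ballI allI impI conjI)
    fix k and t :: nat assume k: "k \<in> states B i" and t: "t \<ge> 1"
    show "reward B i k - closing B i - setup_cost B i +
        ramp B i k t * flow (states B i) (rate B i) (pot D i) k \<le> lam D + real t * hval D i"
      using P(1) k t unfolding arm_feasible_def
      by (intro LIMSEQ_le[OF tendsto_add[OF tendsto_const tendsto_mult[OF tendsto_const lim_flow]]
            tendsto_add[OF lim_lam tendsto_mult[OF tendsto_const lim_h]]]) auto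
    show "reward B i k + ramp B i k t * flow (states B i) (rate B i) (pot D i) k
        \<le> real t * (lam D + hval D i)"
      using P(1) k t unfolding arm_feasible_def
      by (intro LIMSEQ_le[OF tendsto_add[OF tendsto_const tendsto_mult[OF tendsto_const lim_flow]]
            tendsto_mult[OF tendsto_const tendsto_add[OF lim_lam lim_h]]]) auto
  qed
  moreover have "lam D = (\<Sum>i\<in>UNIV. hval D i)"
  proof (rule LIMSEQ_unique[OF lim_lam])
    show "(\<lambda>n. lam (Dn (\<phi> n))) \<longlonglongrightarrow> (\<Sum>i\<in>UNIV. hval D i)"
      unfolding dual_feasibleD(3)[OF Dn(1)] by (intro tendsto_sum lim_h)
  qed
  moreover have hD: "0 \<le> hval D i" for i
    by (rule LIMSEQ_le_const[OF lim_h]) (use h in auto)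
  ultimately have "dual_feasible B D"
    by (auto simp: dual_feasible_iff_arms intro: sum_nonneg)
  moreover have "dual_objective D \<le> dual_objective D'" if "dual_feasible B D'" for D'
    using L_le[OF that] dual_feasibleD(3)[OF that] \<open>lam D = _\<close>
    by (simp add: dual_objective_def D_def)
  ultimately show ?thesis by (auto simp: dual_optimal_def)
qed

text \<open>This keeps the approximation statement from being vacuous: in the never tight case
  \<open>balanced_index\<close> demands a single arm of value at least \<open>lam + hval\<close>,
  and an absorbing state supplies one from a suitable start.\<close>

lemma balanced_index_exists:
  fixes B :: "('i::finite, 's) bandit"
  assumes B: "monotone_bandit B" and D: "dual_optimal B D"
  shows "\<exists>\<pi> c0. balanced_index B D \<pi> c0"
proof (cases "all_tight B D")
  case True
  define \<pi> :: "('i, 's) policy" where "\<pi> = (\<lambda>past c. return_pmf (SOME a. a \<in> index_actions B D c))"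
  have "starts B \<noteq> {}"
  proof -
    have "(SOME x. x \<in> states B j) \<in> states B j" for j
      using monotone_banditD(2)[OF B, of j] by (simp add: some_in_eq)
    then have "\<lparr>state = (\<lambda>j. SOME x. x \<in> states B j), elapsed = (\<lambda>_. 1), last_played = None\<rparr> \<in> starts B"
      by (simp add: starts_def)
    then show ?thesis by blast
  qed
  then obtain c0 where "c0 \<in> starts B" by blast
  moreover have "(SOME a. a \<in> index_actions B D c) \<in> index_actions B D c" for c
    using index_actions_nonempty[of B D c] by (simp add: some_in_eq)
  ultimately have "balanced_index B D \<pi> c0"
    using True unfolding balanced_index_def all_tight_def \<pi>_def by auto
  then show ?thesis by blast
next
  case False
  then obtain i where i: "hval D i > 0" "never_tight B D i" by (auto simp: all_tight_def)
  obtain k where k: "k \<in> states B i" "ramp B i k 1 = 0" "reward B i k = lam D + hval D i"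
    using never_tight_absorbing[OF B D i] by blast
  obtain c0 where "c0 \<in> starts B"
      "lower_value B (\<lambda>past c. return_pmf (Some i)) c0 \<ge> ereal (lam D + hval D i)"
    using play_absorbing_state[OF B k(1,2)] k(3) by auto
  then have "balanced_index B D (\<lambda>past c. return_pmf (Some i)) c0"
    using i by (auto simp: balanced_index_def)
  then show ?thesis by blast
qed

theorem theorem9:
  fixes B :: "('i::finite, 's) bandit"
  assumes "monotone_bandit B"
  shows "(\<exists>D. dual_optimal B D) \<and>
    (\<forall>D. dual_optimal B D \<longrightarrow>
       (\<exists>\<pi> c0. balanced_index B D \<pi> c0) \<and>
       (\<forall>\<pi> c0. balanced_index B D \<pi> c0 \<longrightarrow> lower_value B \<pi> c0 \<ge> optimal_value B / 2))"
proof (intro conjI allI impI)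
  show "\<exists>D. dual_optimal B D" using assms by (rule dual_optimal_exists)
next
  fix D assume "dual_optimal B D"
  then show "\<exists>\<pi> c0. balanced_index B D \<pi> c0" using balanced_index_exists[OF assms] by blast
next
  fix D \<pi> c0 assume "dual_optimal B D" and bi: "balanced_index B D \<pi> c0"
  then have D: "dual_feasible B D" by (simp add: dual_optimal_def)
  have "ereal (lam D) \<le> lower_value B \<pi> c0"
  proof (cases "all_tight B D")
    case True
    then show ?thesis
      using bi by (intro index_lower_value[OF assms D]) (auto simp: balanced_index_def all_tight_def)
  next
    case False
    then obtain i where "hval D i > 0" "ereal (lam D + hval D i) \<le> lower_value B \<pi> c0"
      using bi by (auto simp: balanced_index_def all_tight_def split: if_splits)
    then show ?thesis by (meson ereal_less_eq(3) le_add_same_cancel1 less_imp_le order_trans)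
  qed
  then show "optimal_value B / 2 \<le> lower_value B \<pi> c0"
    using optimal_value_le[OF assms D] by (rule order_trans[rotated])
qed

end
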